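(* Let $k\geq 0$ and $\mathcal{P}\subseteq\mathbb{Z}_{\geq0}$, working with formal power series over a commutative ring $R\supseteq\mathbb{Q}$. Then $$F^{k,\mathcal{P}}(u,z)=\Big(1-z\, e_{\mathcal{P}-1}\big(T^{k,\mathcal{P}}(u,z)\big)\Big)^{-1}.$$
   Context: $[n]=\{1,\dots,n\}$. $e_\mathcal{P}(z)=\sum_{n\in\mathcal{P}}z^n/n!$, $\mathcal{P}-1=\{n-1:n\in\mathcal{P},n\ge1\}$. Labeled rooted tree: tree on vertex set $[m]$ with a distinguished root; children of $v$ are its neighbours farther from the root; the height of a vertex $v$ is the maximal distance from $v$ down to a leaf of its subtree; a tree satisfies $\mathcal{P}$ if each vertex has a number of children in $\mathcal{P}$. $T^{k,\mathcal{P}}(u,z)=\sum_t u^{\chi_k(t)}z^{|t|}/|t|!$ over all labeled rooted trees satisfying $\mathcal{P}$, $\chi_k(t)$ = number of vertices of height $<k$. $F^{k,\mathcal{P}}(u,z)=\sum_{n\ge0}\frac{z^n}{n!}\sum_f u^{\,n-|f^k([n])|}$, the inner sum over all functions $f:[n]\to[n]$ with $|f^{-1}(x)|\in\mathcal{P}$ for every $x\in[n]$ (for $n=0$ the empty function). *)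

theory Defs
  imports "HOL-Computational_Algebra.Formal_Power_Series"
          "HOL-Computational_Algebra.Polynomial"
          "HOL-Library.FuncSet"
begin

text \<open>Bivariate formal power series in u, z over R are represented as
  formal power series in z whose coefficients are polynomials in u
  (all series in the statement are polynomial in u coefficientwise).\<close>

definition natinv :: "nat \<Rightarrow> 'a::comm_ring_1" where
  "natinv n = (THE x. of_nat n * x = 1)"

definition eP :: "nat set \<Rightarrow> 'a::comm_ring_1 poly fps" where
  "eP P = Abs_fps (\<lambda>n. if n \<in> P then [:natinv (fact n):] else 0)"

definition shiftP :: "nat set \<Rightarrow> nat set" where
  "shiftP P = {n - 1 | n. n \<in> P \<and> n \<ge> 1}"

text \<open>A labeled rooted tree on vertex set [m] is encoded by its root r and
  its parent map par (par v = parent of v for v in [m] - {r}, and par v = 0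
  elsewhere); every vertex must reach the root by iterating par.\<close>
definition rooted_trees :: "nat \<Rightarrow> (nat \<times> (nat \<Rightarrow> nat)) set" where
  "rooted_trees m = {(r, par). r \<in> {1..m}
      \<and> (\<forall>v. v \<notin> {1..m} - {r} \<longrightarrow> par v = 0)
      \<and> (\<forall>v \<in> {1..m} - {r}. par v \<in> {1..m})
      \<and> (\<forall>v \<in> {1..m}. \<exists>j. (par ^^ j) v = r)}"

definition children :: "nat \<Rightarrow> nat \<times> (nat \<Rightarrow> nat) \<Rightarrow> nat \<Rightarrow> nat set" where
  "children m t v = {w \<in> {1..m}. w \<noteq> fst t \<and> snd t w = v}"

definition height :: "nat \<Rightarrow> nat \<times> (nat \<Rightarrow> nat) \<Rightarrow> nat \<Rightarrow> nat" where
  "height m t v = Max {j. \<exists>w \<in> {1..m}. (snd t ^^ j) w = v \<and> children m t w = {}}"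

definition satisfies :: "nat set \<Rightarrow> nat \<Rightarrow> nat \<times> (nat \<Rightarrow> nat) \<Rightarrow> bool" where
  "satisfies P m t \<longleftrightarrow> (\<forall>v \<in> {1..m}. card (children m t v) \<in> P)"

definition chi :: "nat \<Rightarrow> nat \<Rightarrow> nat \<times> (nat \<Rightarrow> nat) \<Rightarrow> nat" where
  "chi k m t = card {v \<in> {1..m}. height m t v < k}"

definition TkP :: "nat \<Rightarrow> nat set \<Rightarrow> 'a::comm_ring_1 poly fps" where
  "TkP k P = Abs_fps (\<lambda>m. smult (natinv (fact m))
      (\<Sum>t \<in> {t \<in> rooted_trees m. satisfies P m t}. monom 1 (chi k m t)))"

definition funsP :: "nat set \<Rightarrow> nat \<Rightarrow> (nat \<Rightarrow> nat) set" where
  "funsP P n = {f \<in> {1..n} \<rightarrow>\<^sub>E {1..n}. \<forall>x \<in> {1..n}. card {y \<in> {1..n}. f y = x} \<in> P}"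

definition FkP :: "nat \<Rightarrow> nat set \<Rightarrow> 'a::comm_ring_1 poly fps" where
  "FkP k P = Abs_fps (\<lambda>n. smult (natinv (fact n))
      (\<Sum>f \<in> funsP P n. monom 1 (n - card ((f ^^ k) ` {1..n}))))"

end

theory Submission
  imports Defs "HOL-Combinatorics.Cycles"
begin

unbundle fps_syntax

text \<open>A function on \<open>[n]\<close> is a forest, whose roots are the cyclic points, together with a
  permutation of the roots; a vertex lies in the image of the \<open>k\<close>-th iterate iff it is cyclic or has
  a \<open>k\<close>-fold descendant. Marking one root of a forest gives \<open>(j + 1) V\<^sub>j\<^sub>+\<^sub>1 = V\<^sub>1 V\<^sub>j\<close> for the
  exponential generating functions \<open>V\<^sub>j\<close> of weighted forests with \<open>j\<close> roots, so
  \<open>j! V\<^sub>j = V\<^sub>1\<^sup>j\<close> and \<open>F = \<Sum>j. j! V\<^sub>j = 1 / (1 - V\<^sub>1)\<close>. Deleting the root of a tree leaves a forest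
  whose number of roots lies in \<open>P - 1\<close>, and the same power rule, applied to the weight of \<open>T\<close>, gives
  \<open>V\<^sub>1 = z e\<^bsub>P-1\<^esub>(T)\<close>.\<close>

text \<open>The weight of a forest is a product of factors, one per vertex, so it multiplies over
  trees. A single sum with a free factor \<open>g\<close> serves both series:
  \<open>tree_weight\<close> yields T, \<open>cyclic_weight\<close> yields V_1 and F. The two differ
  only at roots; when the root of a tree is deleted its children become roots, yet must carry the
  weight of T, which is why T needs forests as well. The condition that a vertex has height below
  \<open>k\<close> is phrased as not lying in the range of the \<open>k\<close>-th iterate of the
  parent map: this is decided inside the tree of the vertex, and it has the same form for trees and
  for images of functions. Marking one root replaces the usual unordered set of trees by a recursion
  in j. With j! kept on the left of the power rule, the only divisions are those by the factorials
  in the coefficients.\<close>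

text \<open>A forest on \<open>S\<close> is encoded by its parent map, with \<open>0 \<notin> S\<close> as the parent of all roots; being a
  forest then means that every vertex is eventually mapped to \<open>0\<close>.\<close>
definition forests :: "nat set \<Rightarrow> (nat \<Rightarrow> nat) set" where
  "forests S = {p. (\<forall>x\<in>S. p x \<in> insert 0 S) \<and> (\<forall>x. x \<notin> S \<longrightarrow> p x = 0)
     \<and> (\<forall>x. \<exists>j. (p ^^ j) x = 0)}"

definition roots :: "nat set \<Rightarrow> (nat \<Rightarrow> nat) \<Rightarrow> nat set" where
  "roots S p = {x \<in> S. p x = 0}"

text \<open>The arguments of \<open>g\<close> are the root flag, the number of children and the
  existence of a \<open>k\<close>-fold descendant. Preimages are taken among all naturals: for a
  forest on \<open>S\<close> with 0 \<notin> \<open>S\<close>, only vertices of \<open>S\<close> can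
  lead to the nonzero \<open>v\<close>.\<close>

definition weight ::
  "(bool \<Rightarrow> nat \<Rightarrow> bool \<Rightarrow> 'b) \<Rightarrow> nat \<Rightarrow> nat set \<Rightarrow> (nat \<Rightarrow> nat) \<Rightarrow> 'b::comm_monoid_mult" where
  "weight g k S p = (\<Prod>v\<in>S. g (p v = 0) (card {w. p w = v}) (\<exists>w. (p ^^ k) w = v))"

definition forest_sum ::
  "(bool \<Rightarrow> nat \<Rightarrow> bool \<Rightarrow> 'b) \<Rightarrow> nat \<Rightarrow> nat \<Rightarrow> nat set \<Rightarrow> 'b::comm_semiring_1" where
  "forest_sum g k j S = (\<Sum>p\<in>{p \<in> forests S. card (roots S p) = j}. weight g k S p)"

section \<open>Iterates of self-maps\<close>

lemma funpow_fixed: "f a = a \<Longrightarrow> (f ^^ n) a = a"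
  by (induction n) auto

lemma funpow_absorb:
  assumes "f a = a" "(f ^^ i) x = a" "i \<le> j"
  shows "(f ^^ j) x = a"
proof -
  have "(f ^^ j) x = (f ^^ (j - i)) ((f ^^ i) x)"
    using assms(3) by (metis comp_apply funpow_add le_add_diff_inverse2)
  then show ?thesis using assms by (simp add: funpow_fixed)
qed

text \<open>Backward paths from a point of \<open>B\<close> never leave \<open>B\<close>: there
  \<open>p\<close> and \<open>q\<close> have the same fibres, and \<open>cl\<close> keeps
  predecessors inside. Gluing forests, deleting a root and passing to functions all rest on
  this.\<close>

lemma funpow_eq_iff_on:
  assumes eq: "\<And>x v. v \<in> B \<Longrightarrow> p x = v \<longleftrightarrow> q x = v"
    and cl: "\<And>x. p x \<in> B \<Longrightarrow> x \<in> B"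
    and "v \<in> B"
  shows "(p ^^ n) w = v \<longleftrightarrow> (q ^^ n) w = v"
  using \<open>v \<in> B\<close>
proof (induction n arbitrary: v)
  case (Suc n)
  have "(p ^^ Suc n) w = v \<longleftrightarrow> (\<exists>x\<in>B. p x = v \<and> (p ^^ n) w = x)"
    using cl Suc.prems by auto
  also have "\<dots> \<longleftrightarrow> (\<exists>x\<in>B. q x = v \<and> (q ^^ n) w = x)"
    using Suc.IH eq[OF Suc.prems] by blast
  also have "\<dots> \<longleftrightarrow> (q ^^ Suc n) w = v"
  proof -
    have "x \<in> B" if "q x = v" for x using that eq[OF Suc.prems, of x] cl[of x] Suc.prems by simp
    then show ?thesis by auto
  qed
  finally show ?case .
qed simp

section \<open>Parent maps of forests\<close>

lemma finite_forests:
  assumes "finite S" shows "finite (forests S)"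
proof (rule finite_subset)
  show "forests S \<subseteq> {f. \<forall>x. (x \<in> S \<longrightarrow> f x \<in> insert 0 S) \<and> (x \<notin> S \<longrightarrow> f x = 0)}"
    by (auto simp: forests_def)
qed (use assms in \<open>intro finite_set_of_finite_funs, auto\<close>)

text \<open>Leaving \<open>S\<close> suffices, since one more step from a point outside
  \<open>S\<close> gives 0.\<close>

lemma forestsI:
  assumes "\<And>x. x \<in> S \<Longrightarrow> p x \<in> insert 0 S" "\<And>x. x \<notin> S \<Longrightarrow> p x = 0"
    and "\<And>x. x \<in> S \<Longrightarrow> \<exists>j. (p ^^ j) x \<notin> S"
  shows "p \<in> forests S"
proof -
  have "\<exists>j. (p ^^ j) x = 0" for x
  proof (cases "x \<in> S")
    case True
    then obtain j where "(p ^^ j) x \<notin> S" using assms(3) by blast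
    then have "(p ^^ Suc j) x = 0" using assms(2) by simp
    then show ?thesis by blast
  next
    case False
    then have "(p ^^ Suc 0) x = 0" using assms(2) by simp
    then show ?thesis by blast
  qed
  then show ?thesis using assms(1,2) by (simp add: forests_def)
qed

lemma forests_in: "p \<in> forests S \<Longrightarrow> p x \<in> insert 0 S"
  by (auto simp: forests_def)

lemma forests_out: "p \<in> forests S \<Longrightarrow> x \<notin> S \<Longrightarrow> p x = 0"
  by (auto simp: forests_def)

lemma forests_zero: "p \<in> forests S \<Longrightarrow> 0 \<notin> S \<Longrightarrow> p 0 = 0"
  by (auto simp: forests_def)

lemma forests_nilpotent: "p \<in> forests S \<Longrightarrow> \<exists>j. (p ^^ j) x = 0"
  by (auto simp: forests_def)

lemma forests_funpow_in:
  "p \<in> forests S \<Longrightarrow> x \<in> insert 0 S \<Longrightarrow> (p ^^ n) x \<in> insert 0 S"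
  by (induction n) (use forests_in in auto)

text \<open>The maximal depth over the finite \<open>S\<close> is a common bound because 0 is fixed.
  It serves to bound heights in a tree.\<close>

lemma forests_uniformly_nilpotent:
  assumes "p \<in> forests S" "finite S" "0 \<notin> S"
  shows "\<exists>N. \<forall>n\<ge>N. \<forall>x\<in>S. (p ^^ n) x = 0"
proof -
  obtain d where d: "\<And>x. (p ^^ d x) x = 0"
    using forests_nilpotent[OF assms(1)] by metis
  have "(p ^^ n) x = 0" if "n \<ge> Max (d ` S)" "x \<in> S" for n x
  proof -
    have "d x \<le> Max (d ` S)" using that(2) assms(2) by simp
    then show ?thesis using that funpow_absorb[OF forests_zero[OF assms(1,3)] d[of x]] by simp
  qed
  then show ?thesis by blast
qed

text \<open>The iterate just before the first visit to 0 is the root; minimality of \<open>j\<close>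
  makes it nonzero, hence a point of \<open>S\<close>.\<close>

lemma forests_reach_root:
  assumes "p \<in> forests S" "x \<in> S" "0 \<notin> S"
  shows "\<exists>j. (p ^^ j) x \<in> roots S p"
proof -
  define j where "j = (LEAST j. (p ^^ j) x = 0)"
  have j: "(p ^^ j) x = 0" unfolding j_def by (rule LeastI_ex) (rule forests_nilpotent[OF assms(1)])
  then have "j \<noteq> 0" using assms by (metis funpow_0)
  then obtain i where i: "j = Suc i" by (cases j) auto
  have "(p ^^ i) x \<noteq> 0" using not_less_Least[of i "\<lambda>j. (p ^^ j) x = 0"] i
    unfolding j_def by (metis lessI)
  then have "(p ^^ i) x \<in> S" using forests_funpow_in[OF assms(1), of x i] assms(2) by simp
  then have "(p ^^ i) x \<in> roots S p" using j i by (simp add: roots_def)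
  then show ?thesis ..
qed

text \<open>The hypothesis \<open>p x = 0\<close> covers roots and points outside \<open>S\<close>
  alike: either kind reaches a nonzero point only in zero steps.\<close>

lemma forests_funpow_root:
  assumes "p \<in> forests S" "0 \<notin> S" "p x = 0" "(p ^^ i) x \<noteq> 0"
  shows "i = 0"
proof (rule ccontr)
  assume "i \<noteq> 0"
  then have "(p ^^ i) x = 0"
    using assms(3) funpow_absorb[of p 0 1 x i, OF forests_zero[OF assms(1,2)]] by simp
  then show False using assms(4) by simp
qed

lemma forests_restrict:
  assumes p: "p \<in> forests S" and "A \<subseteq> S" "0 \<notin> S" and cl: "\<And>x. x \<in> A \<Longrightarrow> p x \<in> insert 0 A"
  shows "(\<lambda>x. if x \<in> A then p x else 0) \<in> forests A"
proof (rule forestsI)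
  fix x assume "x \<in> A"
  let ?q = "\<lambda>x. if x \<in> A then p x else 0"
  have "(?q ^^ n) x = (p ^^ n) x \<and> (p ^^ n) x \<in> insert 0 A" for n
  proof (induction n)
    case (Suc n)
    then show ?case using cl forests_zero[OF p] assms by auto
  qed (use \<open>x \<in> A\<close> in simp)
  moreover obtain j where "(p ^^ j) x = 0" using forests_nilpotent[OF p] by blast
  ultimately have "(?q ^^ j) x = 0" by metis
  then show "\<exists>j. (?q ^^ j) x \<notin> A" using assms by (intro exI[of _ j]) auto
qed (use cl in auto)

section \<open>Disjoint unions of forests\<close>

context
  fixes A B :: "nat set" and p q :: "nat \<Rightarrow> nat"
  assumes p: "p \<in> forests A" and q: "q \<in> forests B"
    and disj: "A \<inter> B = {}" and zero: "0 \<notin> A" "0 \<notin> B"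
begin

text \<open>Each map vanishes off its own set, so at every point at most one summand is nonzero and
  the pointwise sum is the union of the two parent maps.\<close>

lemma glue_eq_iff: "v \<in> A \<Longrightarrow> p w + q w = v \<longleftrightarrow> p w = v"
proof -
  assume v: "v \<in> A"
  show ?thesis
  proof (cases "w \<in> A")
    case True
    then have "q w = 0" using disj forests_out[OF q] by blast
    then show ?thesis by simp
  next
    case False
    then have "p w = 0" using forests_out[OF p] by blast
    moreover have "q w \<noteq> v" using forests_in[OF q, of w] v disj zero by auto
    moreover have "v \<noteq> 0" using v zero by metis
    ultimately show ?thesis by simp
  qed
qed

lemma glue_funpow_eq_iff:
  assumes v: "v \<in> A"
  shows "((\<lambda>x. p x + q x) ^^ n) w = v \<longleftrightarrow> (p ^^ n) w = v"
proof (rule funpow_eq_iff_on[where B = A])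
  fix x assume "p x + q x \<in> A"
  then have "p x \<in> A" using glue_eq_iff by metis
  then show "x \<in> A" using forests_out[OF p] zero by metis
qed (use v glue_eq_iff in auto)

lemma glue_zero_iff: "v \<in> A \<Longrightarrow> p v + q v = 0 \<longleftrightarrow> p v = 0"
  using disj forests_out[OF q, of v] by auto

end

lemma glue_forests:
  assumes p: "p \<in> forests A" and q: "q \<in> forests B"
    and disj: "A \<inter> B = {}" and zero: "0 \<notin> A" "0 \<notin> B"
  shows "(\<lambda>x. p x + q x) \<in> forests (A \<union> B)"
proof (rule forestsI)
  fix x
  show "p x + q x \<in> insert 0 (A \<union> B)"
    using forests_in[OF p, of x] forests_in[OF q, of x] forests_out[OF p, of x] forests_out[OF q, of x] disj
    by (cases "x \<in> A"; cases "x \<in> B") auto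
  show "p x + q x = 0" if "x \<notin> A \<union> B" for x
    using that forests_out[OF p, of x] forests_out[OF q, of x] by auto
  \<comment> \<open>After enough steps to exhaust both forests the glued iterate lies neither in
    \<open>A\<close> nor in \<open>B\<close>, where it would be an iterate of \<open>p\<close> or of
    \<open>q\<close>.\<close>
  obtain i j where "(p ^^ i) x = 0" "(q ^^ j) x = 0"
    using forests_nilpotent[OF p] forests_nilpotent[OF q] by blast
  then have "(p ^^ (i + j)) x = 0" "(q ^^ (i + j)) x = 0"
    using funpow_absorb[of p 0 i x "i + j"] funpow_absorb[of q 0 j x "i + j"]
      forests_zero[OF p zero(1)] forests_zero[OF q zero(2)] by simp_all
  then have "((\<lambda>x. p x + q x) ^^ (i + j)) x \<notin> A" "((\<lambda>x. q x + p x) ^^ (i + j)) x \<notin> B"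
    using glue_funpow_eq_iff[OF p q disj zero, of _ "i + j" x]
      glue_funpow_eq_iff[OF q p _ zero(2,1), of _ "i + j" x] disj zero by fastforce+
  then show "\<exists>j. ((\<lambda>x. p x + q x) ^^ j) x \<notin> A \<union> B" by (auto simp: add.commute[of "p _"])
qed

lemma glue_roots:
  assumes p: "p \<in> forests A" and q: "q \<in> forests B"
    and disj: "A \<inter> B = {}" and zero: "0 \<notin> A" "0 \<notin> B"
  shows "roots (A \<union> B) (\<lambda>x. p x + q x) = roots A p \<union> roots B q"
  using glue_zero_iff[OF p q disj zero] glue_zero_iff[OF q p _ zero(2,1)] disj
  by (auto simp: roots_def add.commute)

text \<open>A factor sees only the fibre and the iterated preimages of its vertex and whether the
  vertex is a root; gluing changes none of these.\<close>

lemma weight_glue: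
  assumes p: "p \<in> forests A" and q: "q \<in> forests B"
    and disj: "A \<inter> B = {}" and zero: "0 \<notin> A" "0 \<notin> B" and fin: "finite A" "finite B"
  shows "weight g k (A \<union> B) (\<lambda>x. p x + q x) = weight g k A p * weight g k B q"
proof -
  have disj': "B \<inter> A = {}" using disj by auto
  note A = glue_eq_iff[OF p q disj zero] glue_funpow_eq_iff[OF p q disj zero]
    glue_zero_iff[OF p q disj zero]
  note B = glue_eq_iff[OF q p disj' zero(2,1)] glue_funpow_eq_iff[OF q p disj' zero(2,1)]
    glue_zero_iff[OF q p disj' zero(2,1)]
  have "(\<Prod>v\<in>A. g (p v + q v = 0) (card {w. p w + q w = v}) (\<exists>w. ((\<lambda>x. p x + q x) ^^ k) w = v))
      = weight g k A p"
    unfolding weight_def by (intro prod.cong refl) (simp only: A)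
  moreover have "(\<Prod>v\<in>B. g (q v + p v = 0) (card {w. q w + p w = v}) (\<exists>w. ((\<lambda>x. q x + p x) ^^ k) w = v))
      = weight g k B q"
    unfolding weight_def by (intro prod.cong refl) (simp only: B)
  ultimately show ?thesis
    using fin disj by (simp add: weight_def prod.union_disjoint add.commute)
qed

text \<open>Marking one root of a forest singles out its tree, of vertex set \<open>A\<close>.\<close>
lemma forest_sum_Suc:
  assumes fin: "finite S" and zero: "0 \<notin> S"
  shows "of_nat (Suc j) * forest_sum g k (Suc j) S
    = (\<Sum>A\<in>Pow S. forest_sum g k 1 A * forest_sum g k j (S - A))"
proof -
  \<comment> \<open>Pairs of a forest and one of its roots produce the factor \<open>Suc j\<close>.
    They are matched with triples of a vertex set \<open>A\<close>, a tree on it and a forest with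
    \<open>j\<close> roots on the rest.\<close>
  define X where "X = (SIGMA p:{p \<in> forests S. card (roots S p) = Suc j}. roots S p)"
  define Y where "Y = (SIGMA A:Pow S. {p \<in> forests A. card (roots A p) = 1} \<times>
      {p \<in> forests (S - A). card (roots (S - A) p) = j})"
  \<comment> \<open>The vertices whose path to 0 passes through \<open>c\<close>; for a root
    \<open>c\<close> this is its whole tree, with \<open>c\<close> itself obtained from
    \<open>i = 0\<close>.\<close>
  define tree where "tree = (\<lambda>(p :: nat \<Rightarrow> nat) c. {x \<in> S. \<exists>i. (p ^^ i) x = c})"
  define split where "split = (\<lambda>(p :: nat \<Rightarrow> nat, c). (tree p c, (\<lambda>x. if x \<in> tree p c then p x else 0),
      (\<lambda>x. if x \<in> S - tree p c then p x else 0)))"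
  define join where "join = (\<lambda>(A :: nat set, p :: nat \<Rightarrow> nat, q :: nat \<Rightarrow> nat).
      (\<lambda>x. p x + q x, the_elem (roots A p)))"
  have finr: "finite (roots A p)" if "A \<subseteq> S" for A p
    using that fin by (auto simp: roots_def intro: finite_subset)
  have finF: "finite {p \<in> forests A. R p}" if "A \<subseteq> S" for A R
    using finite_forests[OF finite_subset[OF that fin]] by simp
  have splitX: "split a \<in> Y" "join (split a) = a"
      "(case split a of (A, q, r) \<Rightarrow> weight g k A q * weight g k (S - A) r) = (case a of (p, c) \<Rightarrow> weight g k S p)"
    if "a \<in> X" for a
  proof -
    obtain p c where a: "a = (p, c)" by force
    have p: "p \<in> forests S" and card: "card (roots S p) = Suc j" and c: "c \<in> roots S p"
      using that by (auto simp: X_def a)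
    have cS: "c \<in> S" "p c = 0" using c by (auto simp: roots_def)
    then have "c \<noteq> 0" using zero by metis
    define A q r where "A = tree p c" and "q = (\<lambda>x. if x \<in> A then p x else 0)"
      and "r = (\<lambda>x. if x \<in> S - A then p x else 0)"
    have s: "split a = (A, q, r)" by (simp add: split_def a A_def q_def r_def)
    have AS: "A \<subseteq> S" by (auto simp: A_def tree_def)
    have clA: "p x \<in> insert 0 A" if x: "x \<in> A" for x
    proof -
      obtain i where i: "(p ^^ i) x = c" using x by (auto simp: A_def tree_def)
      show ?thesis
      proof (cases i)
        case 0
        then show ?thesis using i cS by auto
      next
        case (Suc i')
        then have "(p ^^ i') (p x) = c" using i by (simp add: funpow_swap1)
        then show ?thesis using forests_in[OF p, of x] by (auto simp: A_def tree_def)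
      qed
    qed
    have clB: "p x \<in> insert 0 (S - A)" if x: "x \<in> S - A" for x
    proof -
      have "p x \<notin> A"
      proof
        assume "p x \<in> A"
        then obtain i where "(p ^^ i) (p x) = c" by (auto simp: A_def tree_def)
        then have "(p ^^ Suc i) x = c" by (simp add: funpow_swap1)
        then show False using x by (auto simp: A_def tree_def simp del: funpow.simps)
      qed
      then show ?thesis using forests_in[OF p, of x] by auto
    qed
    have q: "q \<in> forests A" unfolding q_def by (rule forests_restrict[OF p AS zero clA])
    have r: "r \<in> forests (S - A)" unfolding r_def by (rule forests_restrict[OF p _ zero clB]) auto
    have qr: "(\<lambda>x. q x + r x) = p" using AS forests_out[OF p] by (auto simp: q_def r_def)
    have "(p ^^ 0) c = c" by simp
    then have "c \<in> A" using cS unfolding A_def tree_def by blast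
    have rA: "roots A q = {c}"
    proof
      show "{c} \<subseteq> roots A q" using \<open>c \<in> A\<close> cS by (auto simp: roots_def q_def)
      show "roots A q \<subseteq> {c}"
      proof
        fix x assume "x \<in> roots A q"
        then have x: "x \<in> roots S p" "x \<in> A" using AS by (auto simp: roots_def q_def)
        then obtain i where i: "(p ^^ i) x = c" by (auto simp: A_def tree_def)
        then have "i = 0" using forests_funpow_root[OF p zero, of x i] x cS \<open>c \<noteq> 0\<close> by (simp add: roots_def)
        then show "x \<in> {c}" using i by simp
      qed
    qed
    have disj: "A \<inter> (S - A) = {}" "0 \<notin> A" "0 \<notin> S - A" "finite A" "finite (S - A)" "A \<union> (S - A) = S"
      using AS zero fin by (auto intro: finite_subset)
    have "roots S p = roots A q \<union> roots (S - A) r"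
      using glue_roots[OF q r disj(1-3)] disj(6) qr by simp
    moreover have "roots A q \<inter> roots (S - A) r = {}" by (auto simp: roots_def)
    ultimately have "card (roots (S - A) r) = j"
      using card rA finr[of "S - A" r] by (auto simp: card_insert_if)
    then show "split a \<in> Y" using q r rA AS by (simp add: s Y_def)
    show "join (split a) = a" unfolding s using qr rA by (simp add: join_def a)
    show "(case split a of (A, q, r) \<Rightarrow> weight g k A q * weight g k (S - A) r) = (case a of (p, c) \<Rightarrow> weight g k S p)"
      using weight_glue[OF q r disj(1-5), of g k] disj(6) qr unfolding s by (simp add: a)
  qed
  have joinY: "join b \<in> X" "split (join b) = b" if "b \<in> Y" for b
  proof -
    obtain A q r where b: "b = (A, q, r)" by (cases b) auto
    have AS: "A \<subseteq> S" and q: "q \<in> forests A" and r: "r \<in> forests (S - A)"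
      and "card (roots A q) = 1" and cr: "card (roots (S - A) r) = j"
      using that by (auto simp: Y_def b)
    then obtain c where c: "roots A q = {c}" by (auto simp: card_1_singleton_iff)
    have disj: "A \<inter> (S - A) = {}" "0 \<notin> A" "0 \<notin> S - A" "finite A" "finite (S - A)" "A \<union> (S - A) = S"
      using AS zero fin by (auto intro: finite_subset)
    define p where "p = (\<lambda>x. q x + r x)"
    have j: "join b = (p, c)" by (simp add: join_def b c p_def)
    have p: "p \<in> forests S" using glue_forests[OF q r disj(1-3)] disj(6) by (simp add: p_def)
    have rp: "roots S p = insert c (roots (S - A) r)"
      using glue_roots[OF q r disj(1-3)] disj(6) c by (simp add: p_def)
    have cA: "c \<in> A" using c by (auto simp: roots_def)
    then have "c \<notin> roots (S - A) r" by (auto simp: roots_def)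
    then have "card (roots S p) = Suc j" using rp cr finr[of "S - A" r] by simp
    then show "join b \<in> X" using p rp by (simp add: X_def j)
    have pw: "(p ^^ n) x = c \<longleftrightarrow> (q ^^ n) x = c" for n x
      using glue_funpow_eq_iff[OF q r disj(1-3) cA] by (simp add: p_def)
    have t: "tree p c = A"
    proof
      show "A \<subseteq> tree p c"
        using forests_reach_root[OF q _ disj(2)] c AS by (auto simp: tree_def pw)
      show "tree p c \<subseteq> A"
      proof
        fix x assume "x \<in> tree p c"
        then obtain i where i: "(q ^^ i) x = c" by (auto simp: tree_def pw)
        show "x \<in> A"
        proof (rule ccontr)
          assume "x \<notin> A"
          moreover have "c \<noteq> 0" using cA disj(2) by metis
          ultimately have "i = 0"
            using forests_funpow_root[OF q disj(2), of x i] forests_out[OF q, of x] i by simp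
          then show False using i \<open>x \<notin> A\<close> cA by simp
        qed
      qed
    qed
    have "(if x \<in> A then p x else 0) = q x" for x
      using forests_out[OF q] forests_out[OF r] by (auto simp: p_def)
    moreover have "(if x \<in> S - A then p x else 0) = r x" for x
      using forests_out[OF q] forests_out[OF r] by (auto simp: p_def)
    ultimately show "split (join b) = b" unfolding j by (simp add: split_def t b del: Diff_iff)
  qed
  have "of_nat (Suc j) * forest_sum g k (Suc j) S = (\<Sum>p\<in>{p \<in> forests S. card (roots S p) = Suc j}. \<Sum>c\<in>roots S p. weight g k S p)"
    by (simp add: forest_sum_def sum_distrib_left)
  also have "\<dots> = (\<Sum>(p, c)\<in>X. weight g k S p)"
    unfolding X_def by (intro sum.Sigma) (use finite_forests[OF fin] finr in auto)
  also have "\<dots> = (\<Sum>(A, q, r)\<in>Y. weight g k A q * weight g k (S - A) r)"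
    by (rule sum.reindex_bij_witness[where i = join and j = split]) (use splitX joinY in auto)
  also have "\<dots> = (\<Sum>A\<in>Pow S. \<Sum>(q, r)\<in>{p \<in> forests A. card (roots A p) = 1} \<times>
      {p \<in> forests (S - A). card (roots (S - A) p) = j}. weight g k A q * weight g k (S - A) r)"
    unfolding Y_def
    using fin finF by (intro sum.Sigma[symmetric]) (simp_all add: finite_cartesian_product)
  also have "\<dots> = (\<Sum>A\<in>Pow S. forest_sum g k 1 A * forest_sum g k j (S - A))"
    by (simp add: forest_sum_def sum_product sum.cartesian_product)
  finally show ?thesis .
qed

subsection \<open>Relabelling\<close>

lemma conj_funpow:
  assumes "bij h"
  shows "((h \<circ> p \<circ> inv h) ^^ n) x = h ((p ^^ n) (inv h x))"
  using assms by (induction n) (simp_all add: bij_is_inj bij_is_surj surj_f_inv_f)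

text \<open>Conjugation transports fibres and iterates; \<open>h 0 = 0\<close> keeps the artificial
  parent of the roots in place.\<close>

lemma conj_forests:
  assumes h: "bij h" "h 0 = 0" and p: "p \<in> forests S" and zero: "0 \<notin> S"
  shows "h \<circ> p \<circ> inv h \<in> forests (h ` S)"
    and "roots (h ` S) (h \<circ> p \<circ> inv h) = h ` roots S p"
    and "weight g k (h ` S) (h \<circ> p \<circ> inv h) = weight g k S p"
proof -
  have inj: "inj h" and surj: "surj h" using h by (auto simp: bij_def)
  have h0: "h x = 0 \<longleftrightarrow> x = 0" for x using inj_eq[OF inj, of x 0] h by simp
  show "h \<circ> p \<circ> inv h \<in> forests (h ` S)"
  proof (rule forestsI)
    fix x assume "x \<in> h ` S"
    then obtain y where y: "x = h y" "y \<in> S" by blast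
    show "(h \<circ> p \<circ> inv h) x \<in> insert 0 (h ` S)"
      using forests_in[OF p, of y] y inj h0 by auto
    obtain j where "(p ^^ j) y = 0" using forests_nilpotent[OF p] by blast
    then have "((h \<circ> p \<circ> inv h) ^^ j) x = 0" using y inj h by (simp add: conj_funpow)
    moreover have "0 \<notin> h ` S" using zero h0 by (metis imageE)
    ultimately show "\<exists>j. ((h \<circ> p \<circ> inv h) ^^ j) x \<notin> h ` S" by metis
  next
    fix x assume "x \<notin> h ` S"
    then have "inv h x \<notin> S" using surj_f_inv_f[OF surj, of x] by (auto simp: image_iff)
    then show "(h \<circ> p \<circ> inv h) x = 0" using forests_out[OF p] h by simp
  qed
  show "roots (h ` S) (h \<circ> p \<circ> inv h) = h ` roots S p"
    using inj by (auto simp: roots_def h0)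
  have "{w. h (p (inv h w)) = h v} = h ` {w. p w = v}" for v
  proof (intro set_eqI iffI)
    fix w assume "w \<in> {w. h (p (inv h w)) = h v}"
    then have "p (inv h w) = v" using inj by (simp add: inj_eq)
    then show "w \<in> h ` {w. p w = v}" using surj_f_inv_f[OF surj, of w] by (metis (mono_tags) image_eqI mem_Collect_eq)
  qed (use inj in auto)
  then have c: "card {w. h (p (inv h w)) = h v} = card {w. p w = v}" for v
    using inj by (simp add: card_image inj_on_subset)
  have e: "(\<exists>w. h ((p ^^ k) (inv h w)) = h v) \<longleftrightarrow> (\<exists>w. (p ^^ k) w = v)" for v
    using inj by (metis inj_eq inv_f_f)
  have "inj_on h S" using inj by (rule inj_on_subset) simp
  then show "weight g k (h ` S) (h \<circ> p \<circ> inv h) = weight g k S p"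
    by (simp add: weight_def prod.reindex conj_funpow h(1) inj h0 c e)
qed

lemma forest_sum_image:
  assumes h: "bij h" "h 0 = 0" and zero: "0 \<notin> S"
  shows "forest_sum g k j (h ` S) = forest_sum g k j S"
proof -
  have inj: "inj h" and surj: "surj h" using h by (auto simp: bij_def)
  have h': "bij (inv h)" "inv h 0 = 0" using h inj by (auto simp: bij_imp_bij_inv intro: inv_f_eq)
  have hh: "inv (inv h) = h" by (rule inv_inv_eq) (rule h)
  have S: "inv h ` h ` S = S" using inj by (simp add: image_inv_f_f)
  have zero': "0 \<notin> h ` S" using zero inj h by (metis imageE injD)
  have c: "card (h ` roots S p) = card (roots S p)" for p
    using inj by (simp add: card_image inj_on_subset)
  have c': "card (inv h ` roots (h ` S) p) = card (roots (h ` S) p)" for p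
    by (rule card_image[OF inj_on_subset[OF bij_is_inj[OF h'(1)] subset_UNIV]])
  show ?thesis unfolding forest_sum_def
  proof (rule sum.reindex_bij_witness[where i = "\<lambda>p. h \<circ> p \<circ> inv h" and j = "\<lambda>p. inv h \<circ> p \<circ> h"])
    fix p assume p: "p \<in> {p \<in> forests (h ` S). card (roots (h ` S) p) = j}"
    show "h \<circ> (inv h \<circ> p \<circ> h) \<circ> inv h = p"
      using surj by (simp add: fun_eq_iff surj_f_inv_f)
    show "inv h \<circ> p \<circ> h \<in> {p \<in> forests S. card (roots S p) = j}"
      and "weight g k S (inv h \<circ> p \<circ> h) = weight g k (h ` S) p"
      using conj_forests[OF h' _ zero', of p, unfolded hh S] p c' by auto
  next
    fix p assume p: "p \<in> {p \<in> forests S. card (roots S p) = j}"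
    show "inv h \<circ> (h \<circ> p \<circ> inv h) \<circ> h = p"
      using inj by (simp add: fun_eq_iff)
    show "h \<circ> p \<circ> inv h \<in> {p \<in> forests (h ` S). card (roots (h ` S) p) = j}"
      using conj_forests[OF h _ zero, of p] p c by auto
  qed
qed

text \<open>Makes \<open>forest_sum\<close> a function of the cardinality, as exponential generating
  functions require. A bijection of \<open>S\<close> onto \<open>T\<close> extends to a permutation
  of all naturals: \<open>T - S\<close> goes to \<open>S - T\<close>, which has the same size, and
  everything else, in particular 0, stays fixed.\<close>

lemma forest_sum_card_cong:
  assumes fin: "finite S" "finite T" and zero: "0 \<notin> S" "0 \<notin> T" and card: "card S = card T"
  shows "forest_sum g k j S = forest_sum g k j T"
proof -
  have "card (T - S) = card (S - T)"
    using fin card by (metis add_left_cancel card_Int_Diff inf_commute)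
  then obtain b where b: "bij_betw b (T - S) (S - T)"
    using fin finite_same_card_bij[of "T - S" "S - T"] by auto
  obtain a where a: "bij_betw a S T" using finite_same_card_bij[OF fin card] by blast
  define h where "h = (\<lambda>x. if x \<in> S then a x else if x \<in> T - S then b x else x)"
  have "bij_betw h S T" using a by (rule bij_betw_cong[THEN iffD1, rotated]) (simp add: h_def)
  moreover have "bij_betw h (T - S) (S - T)"
    using b by (rule bij_betw_cong[THEN iffD1, rotated]) (simp add: h_def)
  moreover have "bij_betw h (- (S \<union> T)) (- (S \<union> T))"
    by (rule bij_betw_cong[THEN iffD1, OF _ bij_betw_id]) (simp add: h_def)
  ultimately have "bij_betw h (S \<union> (T - S) \<union> - (S \<union> T)) (T \<union> (S - T) \<union> - (S \<union> T))"
    by (intro bij_betw_combine) auto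
  moreover have "S \<union> (T - S) \<union> - (S \<union> T) = UNIV" "T \<union> (S - T) \<union> - (S \<union> T) = UNIV" by auto
  ultimately have "bij h" by simp
  moreover have "h 0 = 0" using zero by (simp add: h_def)
  moreover have "h ` S = T" using a by (simp add: h_def bij_betw_def)
  ultimately show ?thesis using forest_sum_image[of h S g k j] zero by simp
qed

text \<open>A nonempty forest has a root, and the empty set carries just the zero map, whose weight
  is an empty product.\<close>

lemma forest_sum_0:
  assumes "finite S" "0 \<notin> S"
  shows "forest_sum g k 0 S = (if S = {} then 1 else 0)"
proof (cases "S = {}")
  case True
  have "(\<lambda>_. 0) \<in> forests {}" by (rule forestsI) auto
  then have "{p \<in> forests {}. card (roots {} p) = 0} = {\<lambda>_. 0}"
    using forests_out by (fastforce simp: roots_def)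
  then show ?thesis using True by (simp add: forest_sum_def weight_def)
next
  case False
  have "roots S p \<noteq> {}" if "p \<in> forests S" for p
    using forests_reach_root[OF that _ assms(2)] False by blast
  then have "{p \<in> forests S. card (roots S p) = 0} = {}"
    using assms(1) by (auto simp: roots_def)
  then show ?thesis using False unfolding forest_sum_def by (simp only: sum.empty if_False)
qed

lemma sum_Pow_card:
  fixes f :: "nat \<Rightarrow> 'b::comm_semiring_1"
  assumes "finite S"
  shows "(\<Sum>A\<in>Pow S. f (card A)) = (\<Sum>i\<le>card S. of_nat (card S choose i) * f i)"
proof -
  have "(\<Sum>A\<in>Pow S. f (card A)) = (\<Sum>i\<le>card S. \<Sum>A\<in>{A \<in> Pow S. card A = i}. f (card A))"
    using assms by (intro sum.group[symmetric]) (auto intro: card_mono)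
  also have "\<dots> = (\<Sum>i\<le>card S. of_nat (card {A. A \<subseteq> S \<and> card A = i}) * f i)"
    by (intro sum.cong refl) (simp add: Pow_def)
  finally show ?thesis using assms by (simp add: n_subsets)
qed

subsection \<open>Deleting the root of a tree\<close>

text \<open>The children of the deleted root \<open>c\<close> are the roots of what remains, so the
  condition on the arity of \<open>c\<close> restricts the number \<open>j\<close> of roots to
  \<open>Q\<close>. The factor of \<open>c\<close> ignores its descendant flag and is 0 or 1;
  \<open>h\<close> ignores the root flag, so the former children keep their factors.\<close>

lemma forest_sum_remove_root:
  fixes g h :: "bool \<Rightarrow> nat \<Rightarrow> bool \<Rightarrow> 'b::comm_semiring_1"
  assumes fin: "finite S" and zero: "0 \<notin> S"
    and g: "\<And>n d. g True n d = (if n \<in> Q then 1 else 0)"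
    and gh: "\<And>r n d. h r n d = g False n d"
  shows "forest_sum g k 1 S = (\<Sum>c\<in>S. \<Sum>j\<in>{j. j \<le> card (S - {c}) \<and> j \<in> Q}. forest_sum h k j (S - {c}))"
proof -
  define X where "X = {p \<in> forests S. card (roots S p) = 1}"
  define Y where "Y = (SIGMA c:S. forests (S - {c}))"
  \<comment> \<open>Children of \<open>c\<close> are redirected to 0; \<open>add\<close> hangs the
    roots below \<open>c\<close> again.\<close>
  define cut where "cut = (\<lambda>p. let c = the_elem (roots S p) in (c, \<lambda>x. if p x = c then 0 else p x))"
  define add where "add = (\<lambda>(c, q). \<lambda>x. if x \<in> roots (S - {c}) q then c else q x)"
  have finr: "finite (roots (S - {c}) q)" for c q using fin by (auto simp: roots_def)
  \<comment> \<open>The relation between a tree and its remainder, put symmetrically so that it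
    serves both \<open>cut\<close> and \<open>add\<close>.\<close>
  have link: "weight g k S p = (if card (roots (S - {c}) q) \<in> Q then weight h k (S - {c}) q else 0)"
      "p \<in> forests S \<longleftrightarrow> q \<in> forests (S - {c})"
    if c: "c \<in> S" "p c = 0" and pq: "\<And>x. p x = c \<longleftrightarrow> x \<in> roots (S - {c}) q"
      and eq: "\<And>x v. v \<in> S - {c} \<Longrightarrow> p x = v \<longleftrightarrow> q x = v"
      and out: "\<And>x. x \<notin> S \<Longrightarrow> p x = 0" "\<And>x. x \<notin> S - {c} \<Longrightarrow> q x = 0"
      and im: "\<And>x. p x \<in> insert 0 S" "\<And>x. q x \<in> insert 0 (S - {c})"
      and pz: "\<And>x. x \<in> S - {c} \<Longrightarrow> p x \<noteq> 0"
    for p q c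
  proof -
    have cl: "x \<in> S - {c}" if "p x \<in> S - {c}" for x
      using that out(1)[of x] c zero by (cases "x = c"; cases "x \<in> S") auto
    have it: "(p ^^ n) w = v \<longleftrightarrow> (q ^^ n) w = v" if "v \<in> S - {c}" for n v w
      by (rule funpow_eq_iff_on[OF eq cl that])
    have "weight g k S p = g True (card {w. p w = c}) (\<exists>w. (p ^^ k) w = c) *
        (\<Prod>v\<in>S - {c}. g (p v = 0) (card {w. p w = v}) (\<exists>w. (p ^^ k) w = v))"
      unfolding weight_def by (subst prod.remove[OF fin c(1)]) (simp add: c)
    also have "(\<Prod>v\<in>S - {c}. g (p v = 0) (card {w. p w = v}) (\<exists>w. (p ^^ k) w = v)) = weight h k (S - {c}) q"
      unfolding weight_def gh
    proof (intro prod.cong refl)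
      fix v assume v: "v \<in> S - {c}"
      show "g (p v = 0) (card {w. p w = v}) (\<exists>w. (p ^^ k) w = v)
          = g False (card {w. q w = v}) (\<exists>w. (q ^^ k) w = v)"
        unfolding eq[OF v] it[OF v] using pz[OF v] by simp
    qed
    also have "{w. p w = c} = roots (S - {c}) q" using pq by auto
    finally show "weight g k S p = (if card (roots (S - {c}) q) \<in> Q then weight h k (S - {c}) q else 0)"
      by (simp add: g)
    show "p \<in> forests S \<longleftrightarrow> q \<in> forests (S - {c})"
    proof
      assume p: "p \<in> forests S"
      show "q \<in> forests (S - {c})"
      proof (rule forestsI)
        fix x
        obtain j where "(p ^^ j) x = 0" using forests_nilpotent[OF p] by blast
        then have "(q ^^ j) x \<notin> S - {c}" using it[of "(q ^^ j) x" j x] zero by (metis Diff_iff)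
        then show "\<exists>j. (q ^^ j) x \<notin> S - {c}" by blast
      qed (use out im in auto)
    next
      assume q: "q \<in> forests (S - {c})"
      show "p \<in> forests S"
      proof (rule forestsI)
        fix x
        obtain j where "(q ^^ j) x = 0" using forests_nilpotent[OF q] by blast
        then have "(p ^^ j) x \<notin> S - {c}" using it[of "(p ^^ j) x" j x] zero by (metis Diff_iff)
        \<comment> \<open>An iterate outside \<open>S - {c}\<close> is \<open>c\<close> or lies
          outside \<open>S\<close>; one more step leads to 0 in both cases.\<close>
        then have "(p ^^ Suc j) x = 0" using c out(1) by auto
        then show "\<exists>j. (p ^^ j) x \<notin> S" using zero by metis
      qed (use out im in auto)
    qed
  qed
  have cutX: "cut p \<in> Y \<and> add (cut p) = p \<and>
      (case cut p of (c, q) \<Rightarrow> if card (roots (S - {c}) q) \<in> Q then weight h k (S - {c}) q else 0) = weight g k S p"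
    if "p \<in> X" for p
  proof -
    have p: "p \<in> forests S" and "card (roots S p) = 1" using that by (auto simp: X_def)
    then obtain c where c: "roots S p = {c}" by (auto simp: card_1_singleton_iff)
    define q where "q = (\<lambda>x. if p x = c then 0 else p x)"
    have cut: "cut p = (c, q)" by (simp add: cut_def c q_def)
    have cp: "x \<in> S \<and> p x = 0 \<longleftrightarrow> x = c" for x
      using eqset_imp_iff[OF c, of x] by (simp add: roots_def)
    have cS: "c \<in> S" "p c = 0" using cp[of c] by simp_all
    have pz: "p x \<noteq> 0" if "x \<in> S - {c}" for x using cp[of x] that by simp
    have c0: "c \<noteq> 0" using cS zero by metis
    have pq: "p x = c \<longleftrightarrow> x \<in> roots (S - {c}) q" for x
    proof
      assume "p x = c"
      then have "x \<in> S" "x \<noteq> c" using forests_out[OF p, of x] c0 cS(2) by metis+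
      then show "x \<in> roots (S - {c}) q" using \<open>p x = c\<close> by (simp add: roots_def q_def)
    next
      assume "x \<in> roots (S - {c}) q"
      then have "x \<in> S - {c}" "q x = 0" by (simp_all add: roots_def)
      then show "p x = c" using pz[of x] unfolding q_def by metis
    qed
    have out: "x \<notin> S - {c} \<Longrightarrow> q x = 0" for x
      using forests_out[OF p, of x] cS by (auto simp: q_def)
    have im: "q x \<in> insert 0 (S - {c})" for x
      using forests_in[OF p, of x] by (auto simp: q_def)
    have eq: "p x = v \<longleftrightarrow> q x = v" if "v \<in> S - {c}" for x v
    proof -
      have "v \<noteq> 0" using that zero by (metis Diff_iff)
      then show ?thesis using that by (auto simp: q_def)
    qed
    note l = link[OF cS pq eq forests_out[OF p] out forests_in[OF p] im pz]
    have "q \<in> forests (S - {c})" using l(2) p by simp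
    moreover have "add (c, q) = p"
    proof
      show "add (c, q) x = p x" for x
        using pq[of x] by (cases "p x = c") (simp_all add: add_def, simp add: q_def)
    qed
    ultimately show ?thesis unfolding cut using cS l(1) by (simp add: Y_def)
  qed
  have addY: "add b \<in> X \<and> cut (add b) = b" if bY: "b \<in> Y" for b
  proof -
    obtain c q where b: "b = (c, q)" by force
    have cS: "c \<in> S" and q: "q \<in> forests (S - {c})" using bY by (auto simp: Y_def b)
    define p where "p = (\<lambda>x. if x \<in> roots (S - {c}) q then c else q x)"
    have add: "add b = p" by (simp add: add_def b p_def)
    have c0: "c \<noteq> 0" using cS zero by metis
    have qc: "q x \<noteq> c" for x using forests_in[OF q, of x] c0 by auto
    have pq: "p x = c \<longleftrightarrow> x \<in> roots (S - {c}) q" for x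
      using qc by (simp add: p_def)
    have pc: "p c = 0" using forests_out[OF q, of c] by (simp add: p_def roots_def)
    have pz: "p x \<noteq> 0" if "x \<in> S - {c}" for x using that c0 by (auto simp: p_def roots_def)
    have out: "x \<notin> S \<Longrightarrow> p x = 0" for x using forests_out[OF q, of x] by (simp add: p_def roots_def)
    have im: "p x \<in> insert 0 S" for x using forests_in[OF q, of x] cS by (auto simp: p_def)
    have eq: "p x = v \<longleftrightarrow> q x = v" if v: "v \<in> S - {c}" for x v
    proof -
      have "v \<noteq> 0" using v zero by (metis Diff_iff)
      then show ?thesis using v by (auto simp: p_def roots_def)
    qed
    have "p \<in> forests S" using link(2)[OF cS pc pq eq out forests_out[OF q] im forests_in[OF q] pz] q by blast
    moreover have r: "roots S p = {c}"
      unfolding roots_def using cS pc pz by (intro set_eqI) (metis (mono_tags, lifting) Diff_iff mem_Collect_eq singleton_iff)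
    moreover have "(if p x = c then 0 else p x) = q x" for x
      using qc[of x] by (auto simp: p_def roots_def)
    ultimately show ?thesis unfolding add by (simp add: X_def cut_def b)
  qed
  have "forest_sum g k 1 S = (\<Sum>p\<in>X. weight g k S p)" by (simp add: forest_sum_def X_def)
  also have "\<dots> = (\<Sum>(c, q)\<in>Y. if card (roots (S - {c}) q) \<in> Q then weight h k (S - {c}) q else 0)"
    by (rule sum.reindex_bij_witness[where i = add and j = cut]) (use cutX addY in blast)+
  also have "\<dots> = (\<Sum>c\<in>S. \<Sum>q\<in>forests (S - {c}). if card (roots (S - {c}) q) \<in> Q then weight h k (S - {c}) q else 0)"
    unfolding Y_def by (intro sum.Sigma[symmetric]) (use fin finite_forests in auto)
  also have "\<dots> = (\<Sum>c\<in>S. \<Sum>j\<in>{j. j \<le> card (S - {c}) \<and> j \<in> Q}. forest_sum h k j (S - {c}))"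
  proof (intro sum.cong refl)
    fix c assume "c \<in> S"
    have "(\<Sum>q\<in>forests (S - {c}). if card (roots (S - {c}) q) \<in> Q then weight h k (S - {c}) q else 0)
        = (\<Sum>q\<in>{q \<in> forests (S - {c}). card (roots (S - {c}) q) \<in> Q}. weight h k (S - {c}) q)"
      using fin finite_forests by (intro sum.inter_filter[symmetric]) auto
    also have "\<dots> = (\<Sum>j\<in>{j. j \<le> card (S - {c}) \<and> j \<in> Q}.
        \<Sum>q\<in>{q \<in> {q \<in> forests (S - {c}). card (roots (S - {c}) q) \<in> Q}. card (roots (S - {c}) q) = j}. weight h k (S - {c}) q)"
      using fin finite_forests
      by (intro sum.group[symmetric]) (auto intro!: card_mono simp: roots_def)
    also have "\<dots> = (\<Sum>j\<in>{j. j \<le> card (S - {c}) \<and> j \<in> Q}. forest_sum h k j (S - {c}))"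
      unfolding forest_sum_def by (intro sum.cong) auto
    finally show "(\<Sum>q\<in>forests (S - {c}). if card (roots (S - {c}) q) \<in> Q then weight h k (S - {c}) q else 0)
        = (\<Sum>j\<in>{j. j \<le> card (S - {c}) \<and> j \<in> Q}. forest_sum h k j (S - {c}))" .
  qed
  finally show ?thesis .
qed

subsection \<open>Rooted trees\<close>

text \<open>\<open>monom 1 1\<close> is the variable u, paid by each vertex without a
  \<open>k\<close>-fold descendant. The factor 0 enforces the arity condition, so sums may run over
  all forests.\<close>

definition tree_weight :: "nat set \<Rightarrow> bool \<Rightarrow> nat \<Rightarrow> bool \<Rightarrow> 'a::comm_ring_1 poly" where
  "tree_weight P r n d = (if n \<in> P then (if d then 1 else monom 1 1) else 0)"

text \<open>A root stands for a cyclic point: its predecessor on the cycle is not a child, hence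
  \<open>shiftP\<close>, and it always lies in the image of the \<open>k\<close>-th iterate.\<close>
definition cyclic_weight :: "nat set \<Rightarrow> bool \<Rightarrow> nat \<Rightarrow> bool \<Rightarrow> 'a::comm_ring_1 poly" where
  "cyclic_weight P r n d = (if r then (if n \<in> shiftP P then 1 else 0) else tree_weight P r n d)"

lemma prod_monom_if:
  assumes "finite S"
  shows "(\<Prod>v\<in>S. if a v then (if b v then 1 else monom 1 1) else 0)
    = (if \<forall>v\<in>S. a v then monom 1 (card {v \<in> S. \<not> b v}) else (0 :: 'a::comm_ring_1 poly))"
  using assms
proof (induction S rule: finite_induct)
  case empty
  then show ?case by (simp add: monom_0)
next
  case (insert x S)
  have "{v \<in> insert x S. \<not> b v} = (if b x then {v \<in> S. \<not> b v} else insert x {v \<in> S. \<not> b v})"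
    by auto
  then show ?case using insert by (auto simp: mult_monom)
qed

lemma weight_tree_weight:
  assumes "finite S"
  shows "weight (tree_weight P) k S p = (if \<forall>v\<in>S. card {w. p w = v} \<in> P
    then monom 1 (card {v \<in> S. \<not> (\<exists>w. (p ^^ k) w = v)}) else 0)"
  unfolding weight_def tree_weight_def by (rule prod_monom_if[OF assms])

lemma weight_cyclic_weight:
  assumes "finite S"
  shows "weight (cyclic_weight P) k S p =
    (if \<forall>v\<in>S. card {w. p w = v} \<in> (if p v = 0 then shiftP P else P)
     then monom 1 (card {v \<in> S. \<not> (p v = 0 \<or> (\<exists>w. (p ^^ k) w = v))}) else 0)"
  unfolding weight_def prod_monom_if[OF assms, symmetric]
  by (intro prod.cong refl) (simp add: cyclic_weight_def tree_weight_def)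

text \<open>The given encoding already sends the root and all points outside [m] to 0, so the same
  parent map serves on both sides and determines \<open>r\<close> as its only root.\<close>

lemma rooted_trees_iff: "(r, p) \<in> rooted_trees m \<longleftrightarrow> p \<in> forests {1..m} \<and> roots {1..m} p = {r}"
proof
  assume t: "(r, p) \<in> rooted_trees m"
  have t': "r \<in> {1..m} \<and> (\<forall>v. v \<notin> {1..m} - {r} \<longrightarrow> p v = 0)
      \<and> (\<forall>v \<in> {1..m} - {r}. p v \<in> {1..m}) \<and> (\<forall>v \<in> {1..m}. \<exists>j. (p ^^ j) v = r)"
    using t unfolding rooted_trees_def mem_Collect_eq case_prod_conv .
  have r: "r \<in> {1..m}" using t' by (rule conjunct1)
  have out: "\<And>v. v \<notin> {1..m} - {r} \<Longrightarrow> p v = 0"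
    using t'[THEN conjunct2, THEN conjunct1] by simp
  have im: "\<And>v. v \<in> {1..m} - {r} \<Longrightarrow> p v \<in> {1..m}"
    using t'[THEN conjunct2, THEN conjunct2, THEN conjunct1] by (rule bspec)
  have reach: "\<And>v. v \<in> {1..m} \<Longrightarrow> \<exists>j. (p ^^ j) v = r"
    using t'[THEN conjunct2, THEN conjunct2, THEN conjunct2] by (rule bspec)
  have "p \<in> forests {1..m}"
  proof (rule forestsI)
    fix x assume x: "x \<in> {1..m}"
    show "p x \<in> insert 0 {1..m}" using im[of x] out[of x] x by (cases "x = r") auto
    obtain j where "(p ^^ j) x = r" using reach x by blast
    then have "(p ^^ Suc j) x = 0" using out[of r] by simp
    then show "\<exists>j. (p ^^ j) x \<notin> {1..m}" by (metis atLeastAtMost_iff not_one_le_zero)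
  qed (use out in auto)
  moreover have "roots {1..m} p = {r}"
    using r out[of r] im by (fastforce simp: roots_def)
  ultimately show "p \<in> forests {1..m} \<and> roots {1..m} p = {r}" ..
next
  assume pr: "p \<in> forests {1..m} \<and> roots {1..m} p = {r}"
  then have p: "p \<in> forests {1..m}" and rt: "roots {1..m} p = {r}" by blast+
  have rp: "x \<in> {1..m} \<and> p x = 0 \<longleftrightarrow> x = r" for x
    using eqset_imp_iff[OF rt, of x] by (simp add: roots_def)
  have r: "r \<in> {1..m}" "p r = 0" using rp[of r] by simp_all
  have nr: "p x \<noteq> 0" if "x \<in> {1..m} - {r}" for x using rp[of x] that by simp
  have "p v \<in> {1..m}" if "v \<in> {1..m} - {r}" for v
    using forests_in[OF p, of v] nr[OF that] by auto
  moreover have "p v = 0" if "v \<notin> {1..m} - {r}" for v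
    using forests_out[OF p, of v] r that by auto
  moreover have "\<exists>j. (p ^^ j) v = r" if "v \<in> {1..m}" for v
    using forests_reach_root[OF p that] pr by simp
  ultimately show "(r, p) \<in> rooted_trees m" using r by (simp add: rooted_trees_def)
qed

text \<open>As \<open>v\<close> is nonzero, any \<open>w\<close> with \<open>p w = v\<close> is
  automatically a vertex other than the root.\<close>

lemma children_rooted_tree:
  assumes t: "(r, p) \<in> rooted_trees m" and v: "v \<in> {1..m}"
  shows "children m (r, p) v = {w. p w = v}"
proof -
  have "w \<in> {1..m} \<and> w \<noteq> r" if "p w = v" for w
    using that t v by (auto simp: rooted_trees_def)
  then show ?thesis by (auto simp: children_def)
qed

text \<open>\<open>J\<close> collects the lengths of all descending paths from \<open>v\<close>; it
  is finite and closed under smaller numbers. A longest path ends in a leaf, since a child of its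
  endpoint would prolong it, so the maximum over leaves in \<open>height\<close> equals the maximum
  of \<open>J\<close>.\<close>

lemma height_less_iff:
  assumes t: "(r, p) \<in> rooted_trees m" and v: "v \<in> {1..m}"
  shows "height m (r, p) v < k \<longleftrightarrow> \<not> (\<exists>w. (p ^^ k) w = v)"
proof -
  have p: "p \<in> forests {1..m}" using t rooted_trees_iff by blast
  have zero: "0 \<notin> {1..m}" by simp
  define J where "J = {j. \<exists>w. (p ^^ j) w = v}"
  have dom: "w \<in> {1..m}" if "(p ^^ j) w = v" for j w
  proof (rule ccontr)
    assume w: "w \<notin> {1..m}"
    then have "j = 0"
      using forests_funpow_root[OF p zero forests_out[OF p w], of j] that v by auto
    then show False using that w v by simp
  qed
  obtain N where N: "\<And>n x. N \<le> n \<Longrightarrow> x \<in> {1..m} \<Longrightarrow> (p ^^ n) x = 0"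
    using forests_uniformly_nilpotent[OF p _ zero] by (metis finite_atLeastAtMost)
  have "J \<subseteq> {..<N}"
  proof
    fix j assume "j \<in> J"
    then obtain w where "(p ^^ j) w = v" by (auto simp: J_def)
    then show "j \<in> {..<N}" using N[of j w] dom[of j w] v by (cases "N \<le> j") auto
  qed
  then have fin: "finite J" by (rule finite_subset) simp
  have "(p ^^ 0) v = v" by simp
  then have "0 \<in> J" unfolding J_def by blast
  then have ne: "J \<noteq> {}" by blast
  define M where "M = Max J"
  have "M \<in> J" unfolding M_def using fin ne by (rule Max_in)
  then obtain w where w: "(p ^^ M) w = v" by (auto simp: J_def)
  have "children m (r, p) w = {}"
  proof (rule ccontr)
    assume "children m (r, p) w \<noteq> {}"
    then obtain x where "p x = w" by (auto simp: children_def)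
    then have "(p ^^ Suc M) x = v" using w by (simp add: funpow_swap1)
    then have "Suc M \<in> J" unfolding J_def by blast
    then show False using Max_ge[OF fin, of "Suc M"] by (simp add: M_def)
  qed
  then have MJ: "M \<in> {j. \<exists>w\<in>{1..m}. (snd (r, p) ^^ j) w = v \<and> children m (r, p) w = {}}"
    using w dom[OF w] by auto
  have sub: "{j. \<exists>w\<in>{1..m}. (snd (r, p) ^^ j) w = v \<and> children m (r, p) w = {}} \<subseteq> J"
    by (auto simp: J_def)
  have "height m (r, p) v = M"
    unfolding height_def
    by (rule Max_eqI[OF finite_subset[OF sub fin] _ MJ]) (use sub Max_ge[OF fin] in \<open>auto simp: M_def\<close>)
  moreover have "k \<in> J \<longleftrightarrow> k \<le> M"
  proof
    assume "k \<le> M"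
    then have "(p ^^ k) ((p ^^ (M - k)) w) = v"
      using w by (metis comp_apply funpow_add le_add_diff_inverse)
    then show "k \<in> J" unfolding J_def by blast
  qed (use Max_ge[OF fin] in \<open>simp add: M_def\<close>)
  ultimately show ?thesis unfolding J_def by auto
qed

lemma sum_rooted_trees:
  "(\<Sum>t\<in>{t \<in> rooted_trees m. satisfies P m t}. monom 1 (chi k m t))
    = forest_sum (tree_weight P :: _ \<Rightarrow> _ \<Rightarrow> _ \<Rightarrow> 'a::comm_ring_1 poly) k 1 {1..m}"
proof -
  define F where "F = {p \<in> forests {1..m}. card (roots {1..m} p) = 1}"
  define e where "e = (\<lambda>p. (the_elem (roots {1..m} p), p))"
  define ok where "ok = (\<lambda>p :: nat \<Rightarrow> nat. \<forall>v\<in>{1..m}. card {w. p w = v} \<in> P)"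
  have finF: "finite F" unfolding F_def using finite_forests by simp
  have eF: "e p \<in> rooted_trees m" if "p \<in> F" for p
  proof -
    obtain r where "roots {1..m} p = {r}" using \<open>p \<in> F\<close> by (auto simp: F_def card_1_singleton_iff)
    then show ?thesis using that rooted_trees_iff[of r p m] by (simp add: e_def F_def)
  qed
  have tF: "snd t \<in> F \<and> e (snd t) = t" if "t \<in> rooted_trees m" for t
    using that rooted_trees_iff[of "fst t" "snd t" m] by (simp add: F_def e_def prod_eq_iff)
  have ok: "satisfies P m t \<longleftrightarrow> ok (snd t)" if t: "t \<in> rooted_trees m" for t
  proof -
    have "children m t v = {w. snd t w = v}" if "v \<in> {1..m}" for v
      using children_rooted_tree[of "fst t" "snd t"] t that by simp
    then show ?thesis by (simp add: satisfies_def ok_def)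
  qed
  have chi: "chi k m t = card {v \<in> {1..m}. \<not> (\<exists>w. (snd t ^^ k) w = v)}" if t: "t \<in> rooted_trees m" for t
  proof -
    have "{v \<in> {1..m}. height m t v < k} = {v \<in> {1..m}. \<not> (\<exists>w. (snd t ^^ k) w = v)}"
      using height_less_iff[of "fst t" "snd t" m _ k] t by auto
    then show ?thesis by (simp add: chi_def)
  qed
  have "(\<Sum>t\<in>{t \<in> rooted_trees m. satisfies P m t}. monom 1 (chi k m t))
      = (\<Sum>p\<in>{p \<in> F. ok p}. monom (1 :: 'a) (card {v \<in> {1..m}. \<not> (\<exists>w. (p ^^ k) w = v)}))"
  proof (rule sum.reindex_bij_witness[where i = e and j = snd])
    fix p assume p: "p \<in> {p \<in> F. ok p}"
    show "snd (e p) = p" by (simp add: e_def)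
    then show "e p \<in> {t \<in> rooted_trees m. satisfies P m t}" using p eF ok[of "e p"] by simp
  qed (use tF ok chi in auto)
  also have "\<dots> = (\<Sum>p\<in>F. weight (tree_weight P) k {1..m} p)"
    unfolding sum.inter_filter[OF finF] ok_def
    by (intro sum.cong refl weight_tree_weight[symmetric]) simp
  finally show ?thesis by (simp add: forest_sum_def F_def)
qed

subsection \<open>Functions as permuted forests\<close>

definition cyclic_points :: "nat set \<Rightarrow> (nat \<Rightarrow> nat) \<Rightarrow> nat set" where
  "cyclic_points S f = {x \<in> S. \<exists>i>0. (f ^^ i) x = x}"

context
  fixes S :: "nat set" and f p \<sigma> :: "nat \<Rightarrow> nat"
  assumes fin: "finite S" and zero: "0 \<notin> S" and p: "p \<in> forests S"
    and \<sigma>: "\<sigma> permutes roots S p"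
    and f: "\<And>x. x \<in> S \<Longrightarrow> f x = (if p x = 0 then \<sigma> x else p x)"
begin

lemma join_root: "x \<in> roots S p \<Longrightarrow> f x = \<sigma> x"
  using f by (simp add: roots_def)

lemma join_in: "x \<in> S \<Longrightarrow> f x \<in> S"
  using f[of x] forests_in[OF p, of x] permutes_in_image[OF \<sigma>, of x] by (auto simp: roots_def)

lemma join_funpow_root: "x \<in> roots S p \<Longrightarrow> (f ^^ n) x = (\<sigma> ^^ n) x"
proof (induction n)
  case (Suc n)
  have "(\<sigma> ^^ n) x \<in> roots S p"
    using permutes_in_image[OF permutes_funpow[OF \<sigma>]] Suc.prems by simp
  then show ?case using Suc join_root by simp
qed simp

lemma forest_funpow_dom:
  assumes "(p ^^ n) w = v" "v \<in> S" shows "w \<in> S"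
proof (rule ccontr)
  assume w: "w \<notin> S"
  have "v \<noteq> 0" using assms(2) zero by metis
  then have "n = 0" using forests_funpow_root[OF p zero forests_out[OF p w], of n] assms(1) by simp
  then show False using w assms by simp
qed

lemma join_eq_iff:
  assumes "v \<in> S - roots S p" "w \<in> S" shows "f w = v \<longleftrightarrow> p w = v"
proof -
  have "v \<noteq> 0" using assms(1) zero by (metis Diff_iff)
  then show ?thesis
    using f[OF assms(2)] assms permutes_in_image[OF \<sigma>, of w] by (auto simp: roots_def)
qed

lemma join_funpow_eq_iff:
  assumes v: "v \<in> S - roots S p" and "w \<in> S"
  shows "(f ^^ n) w = v \<longleftrightarrow> (p ^^ n) w = v"
proof -
  \<comment> \<open>Off \<open>S\<close> nothing is known about \<open>f\<close>, which might lead
    back into \<open>S\<close>. Setting it to 0 there leaves orbits inside \<open>S\<close>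
    unchanged and keeps predecessors of nonroots inside \<open>S\<close>.\<close>
  define g where "g = (\<lambda>x. if x \<in> S then f x else 0)"
  have gf: "(g ^^ n) w = (f ^^ n) w \<and> (f ^^ n) w \<in> S" for n
    by (induction n) (use \<open>w \<in> S\<close> join_in in \<open>auto simp: g_def\<close>)
  have "(g ^^ n) w = v \<longleftrightarrow> (p ^^ n) w = v"
  proof (rule funpow_eq_iff_on[where B = "S - roots S p"])
    show "g x = v \<longleftrightarrow> p x = v" if "v \<in> S - roots S p" for x v
    proof (cases "x \<in> S")
      case False
      then show ?thesis using forests_out[OF p] by (simp add: g_def)
    qed (use join_eq_iff that in \<open>simp add: g_def\<close>)
    show "x \<in> S - roots S p" if "g x \<in> S - roots S p" for x
    proof -
      have "x \<in> S" using that zero by (auto simp: g_def split: if_splits)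
      moreover have "x \<notin> roots S p"
      proof
        assume x: "x \<in> roots S p"
        then have "g x \<in> roots S p"
          using join_root[OF x] permutes_in_image[OF \<sigma>, of x] \<open>x \<in> S\<close> by (simp add: g_def)
        then show False using that by simp
      qed
      ultimately show ?thesis by simp
    qed
  qed (rule v)
  then show ?thesis using gf by simp
qed

text \<open>Roots are periodic because a permutation of the finite root set has finite order. A
  periodic nonroot would be periodic under \<open>p\<close> too, contradicting the eventual arrival
  at 0.\<close>

lemma cyclic_points_join: "cyclic_points S f = roots S p"
proof
  show "roots S p \<subseteq> cyclic_points S f"
  proof
    fix x assume x: "x \<in> roots S p"
    have "finite (roots S p)" using fin by (simp add: roots_def)
    then have "permutation \<sigma>" using \<sigma> permutation_permutes by blast
    then obtain n where "\<sigma> ^^ n = id" "n > 0" by (rule permutation_is_nilpotent)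
    then have "(f ^^ n) x = x" using join_funpow_root[OF x] by simp
    then show "x \<in> cyclic_points S f"
      using \<open>n > 0\<close> x unfolding cyclic_points_def roots_def by blast
  qed
  show "cyclic_points S f \<subseteq> roots S p"
  proof
    fix x assume "x \<in> cyclic_points S f"
    then obtain i where i: "x \<in> S" "i > 0" "(f ^^ i) x = x" unfolding cyclic_points_def by blast
    show "x \<in> roots S p"
    proof (rule ccontr)
      assume "x \<notin> roots S p"
      then have "(p ^^ i) x = x" using join_funpow_eq_iff[of x x i] i by simp
      then have "((p ^^ i) ^^ j) x = x" for j by (rule funpow_fixed)
      then have x: "(p ^^ (i * j)) x = x" for j by (simp add: funpow_mult)
      obtain j where "(p ^^ j) x = 0" using forests_nilpotent[OF p] by blast
      then have "(p ^^ (i * j)) x = 0"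
        using funpow_absorb[of p 0 j x "i * j"] forests_zero[OF p zero] i(2) by simp
      then show False using x i(1) zero by simp
    qed
  qed
qed

text \<open>The \<open>k\<close>-th power of \<open>\<sigma>\<close> still permutes the roots, so
  all of them are hit; a path into any other point avoids the roots and is a path of
  \<open>p\<close>.\<close>

lemma join_image_iff:
  assumes "x \<in> S"
  shows "x \<in> (f ^^ k) ` S \<longleftrightarrow> p x = 0 \<or> (\<exists>w. (p ^^ k) w = x)"
proof (cases "x \<in> roots S p")
  case True
  have "(\<sigma> ^^ k) ` roots S p = roots S p" using permutes_image[OF permutes_funpow[OF \<sigma>]] .
  then obtain y where "y \<in> roots S p" "(\<sigma> ^^ k) y = x" using True by (metis imageE)
  then have "y \<in> S" "(f ^^ k) y = x" using join_funpow_root by (auto simp: roots_def)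
  then have "x \<in> (f ^^ k) ` S" by blast
  then show ?thesis using True by (simp add: roots_def)
next
  case False
  then have "x \<in> S - roots S p" using assms by simp
  then have "x \<in> (f ^^ k) ` S \<longleftrightarrow> (\<exists>w\<in>S. (p ^^ k) w = x)"
    using join_funpow_eq_iff[of x _ k] by (auto simp: image_iff eq_commute[of x])
  also have "\<dots> \<longleftrightarrow> (\<exists>w. (p ^^ k) w = x)" using forest_funpow_dom[of k _ x] assms by blast
  finally show ?thesis using False assms by (simp add: roots_def)
qed

text \<open>Besides its children a root has exactly one preimage, its predecessor under
  \<open>\<sigma>\<close>, which is itself a root. The arity is therefore one less than the size of
  the fibre.\<close>

lemma join_card_preimage:
  assumes x: "x \<in> S"
  shows "card {y \<in> S. f y = x} \<in> P \<longleftrightarrow> card {w. p w = x} \<in> (if p x = 0 then shiftP P else P)"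
proof (cases "x \<in> roots S p")
  case False
  have "y \<in> S" if "p y = x" for y using forest_funpow_dom[of 1 y x] that x by simp
  then have "{y \<in> S. f y = x} = {w. p w = x}" using join_eq_iff[of x] False x by auto
  then show ?thesis using False x by (simp add: roots_def)
next
  case True
  have x0: "x \<noteq> 0" using x zero by metis
  have dom: "y \<in> S" if "p y = x" for y using forest_funpow_dom[of 1 y x] that x by simp
  define y where "y = inv \<sigma> x"
  have y: "\<sigma> y = x" unfolding y_def using permutes_inverses(1)[OF \<sigma>] .
  then have yr: "y \<in> roots S p" using permutes_in_image[OF \<sigma>, of y] True by simp
  have "f z = x \<longleftrightarrow> z = y \<or> p z = x" if z: "z \<in> S" for z
  proof (cases "p z = 0")
    case True
    then show ?thesis using f[OF z] x0 y permutes_inj[OF \<sigma>] by (auto dest: injD)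
  next
    case False
    then show ?thesis using f[OF z] yr by (auto simp: roots_def)
  qed
  then have "{z \<in> S. f z = x} = insert y {w. p w = x}" using dom yr by (auto simp: roots_def)
  moreover have "finite {w. p w = x}" using dom by (intro finite_subset[OF _ fin]) auto
  moreover have "y \<notin> {w. p w = x}" using yr x0 by (auto simp: roots_def)
  ultimately have "card {z \<in> S. f z = x} = Suc (card {w. p w = x})" by simp
  moreover have "n \<in> shiftP P \<longleftrightarrow> Suc n \<in> P" for n
    unfolding shiftP_def by (auto intro: exI[of _ "Suc n"])
  ultimately show ?thesis using True by (simp add: roots_def)
qed

text \<open>The exponent counts the points missed by the \<open>k\<close>-th iterate, which are
  exactly the vertices that pay u.\<close>

lemma join_weight:
  "(if \<forall>x\<in>S. card {y \<in> S. f y = x} \<in> P then monom 1 (card S - card ((f ^^ k) ` S)) else 0)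
    = weight (cyclic_weight P) k S p"
proof -
  have "(f ^^ k) x \<in> S" if "x \<in> S" for x
    using that by (induction k) (use join_in in auto)
  then have sub: "(f ^^ k) ` S \<subseteq> S" by blast
  then have "card S - card ((f ^^ k) ` S) = card (S - (f ^^ k) ` S)"
    using fin by (simp add: card_Diff_subset finite_subset)
  also have "S - (f ^^ k) ` S = {v \<in> S. \<not> (p v = 0 \<or> (\<exists>w. (p ^^ k) w = v))}"
    using join_image_iff[of _ k] by blast
  finally show ?thesis
    unfolding weight_cyclic_weight[OF fin] by (simp only: join_card_preimage cong: ball_cong)
qed

end

text \<open>Cutting every edge that starts at a periodic point leaves the forest; the cut edges form
  the permutation.\<close>

lemma cyclic_split:
  assumes fin: "finite S" and zero: "0 \<notin> S" and f: "\<And>x. x \<in> S \<Longrightarrow> f x \<in> S"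
  defines "C \<equiv> cyclic_points S f"
  defines "p \<equiv> (\<lambda>x. if x \<in> S - C then f x else 0)" and "\<sigma> \<equiv> (\<lambda>x. if x \<in> C then f x else x)"
  shows "p \<in> forests S" "roots S p = C" "\<sigma> permutes C"
proof -
  have CS: "C \<subseteq> S" by (auto simp: C_def cyclic_points_def)
  have fn: "(f ^^ n) x \<in> S" if "x \<in> S" for x n using that by (induction n) (use f in auto)
  have fC: "f x \<in> C" if x: "x \<in> C" for x
  proof -
    obtain i where i: "x \<in> S" "i > 0" "(f ^^ i) x = x"
      using x by (auto simp: C_def cyclic_points_def)
    then have "(f ^^ i) (f x) = f x" by (simp flip: funpow_swap1)
    then show ?thesis using i f unfolding C_def cyclic_points_def by blast
  qed
  have fnC: "(f ^^ n) x \<in> C" if "x \<in> C" for x n using that by (induction n) (use fC in auto)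
  have surj: "\<exists>y\<in>C. f y = x" if x: "x \<in> C" for x
  proof -
    obtain i where i: "i > 0" "(f ^^ i) x = x"
      using x by (auto simp: C_def cyclic_points_def)
    then obtain i' where "i = Suc i'" by (cases i) auto
    then have "f ((f ^^ i') x) = x" using i by simp
    then show ?thesis using fnC[OF x] by blast
  qed
  have "f ` C = C" using fC surj by blast
  then have "inj_on f C" using fin CS by (intro eq_card_imp_inj_on) (auto intro: finite_subset)
  then have "bij_betw f C C" using \<open>f ` C = C\<close> by (simp add: bij_betw_def)
  then have "bij_betw \<sigma> C C" by (rule bij_betw_cong[THEN iffD1, rotated]) (simp add: \<sigma>_def)
  then show "\<sigma> permutes C" by (rule bij_imp_permutes) (simp add: \<sigma>_def)
  show "roots S p = C"
  proof -
    have "p x = 0 \<longleftrightarrow> x \<in> C" if "x \<in> S" for x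
      using f[OF that] zero that unfolding p_def by (metis Diff_iff)
    then show ?thesis using CS by (auto simp: roots_def)
  qed
  show "p \<in> forests S"
  proof (rule forestsI)
    fix x assume x: "x \<in> S"
    show "p x \<in> insert 0 S" using f x by (simp add: p_def)
    \<comment> \<open>Pigeonhole: \<open>card S + 1\<close> iterates in \<open>S\<close> must
      collide, and the earlier of two equal iterates is periodic.\<close>
    have "\<not> inj_on (\<lambda>n. (f ^^ n) x) {..card S}"
    proof
      assume "inj_on (\<lambda>n. (f ^^ n) x) {..card S}"
      moreover have "(\<lambda>n. (f ^^ n) x) ` {..card S} \<subseteq> S" using fn[OF x] by blast
      ultimately have "card {..card S} \<le> card S" using fin by (rule card_inj_on_le)
      then show False by simp
    qed
    then obtain a b where "(f ^^ a) x = (f ^^ b) x" "a \<noteq> b" unfolding inj_on_def by blast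
    then obtain i j where ij: "(f ^^ i) x = (f ^^ j) x" "i < j" by (metis nat_neq_iff)
    have "(f ^^ (j - i)) ((f ^^ i) x) = (f ^^ i) x"
      using ij by (metis comp_apply funpow_add le_add_diff_inverse2 less_imp_le)
    then have iC: "(f ^^ i) x \<in> C"
      using ij(2) fn[OF x] unfolding C_def cyclic_points_def by (metis (mono_tags, lifting) mem_Collect_eq zero_less_diff)
    \<comment> \<open>The \<open>p\<close>-orbit follows the \<open>f\<close>-orbit while it stays
      in \<open>S - C\<close>, so at step \<open>i\<close>, where the latter is in \<open>C\<close>,
      it must be outside \<open>S - C\<close>.\<close>
    have "(p ^^ n) x \<in> S - C \<Longrightarrow> (p ^^ n) x = (f ^^ n) x" for n
    proof (induction n)
      case (Suc n)
      then have "(p ^^ n) x \<in> S - C" using zero by (auto simp: p_def split: if_splits)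
      then show ?case using Suc by (simp add: p_def)
    qed simp
    then have "(p ^^ i) x \<notin> S - C" using iC by fastforce
    then have "p ((p ^^ i) x) = 0" by (simp only: p_def if_False)
    then have "(p ^^ Suc i) x = 0" by simp
    then show "\<exists>j. (p ^^ j) x \<notin> S" using zero by metis
  qed (simp add: p_def)
qed

lemma sum_funsP:
  "(\<Sum>f\<in>funsP P n. monom 1 (n - card ((f ^^ k) ` {1..n})))
    = (\<Sum>j\<le>n. of_nat (fact j) *
        forest_sum (cyclic_weight P :: _ \<Rightarrow> _ \<Rightarrow> _ \<Rightarrow> 'a::comm_ring_1 poly) k j {1..n})"
proof -
  define S where "S = {1..n}"
  have fin: "finite S" and zero: "0 \<notin> S" and card: "card S = n" by (auto simp: S_def)
  define E where "E = S \<rightarrow>\<^sub>E S"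
  define Y where "Y = (SIGMA p:forests S. {\<sigma>. \<sigma> permutes roots S p})"
  define split where "split = (\<lambda>f. let C = cyclic_points S f in
    (\<lambda>x. if x \<in> S - C then f x else 0, \<lambda>x. if x \<in> C then f x else x))"
  define join where "join = (\<lambda>(p :: nat \<Rightarrow> nat, \<sigma>). \<lambda>x\<in>S. if p x = 0 then \<sigma> x else p x)"
  \<comment> \<open>Extending the summand by 0 lets the bijection run between all maps of
    \<open>S\<close> and all pairs, the condition on fibres being absorbed into the weight.\<close>
  define w where "w = (\<lambda>f. if \<forall>x\<in>S. card {y \<in> S. f y = x} \<in> P
      then monom (1 :: 'a) (card S - card ((f ^^ k) ` S)) else 0)"
  have finr: "finite (roots S p)" for p using fin by (simp add: roots_def)
  have finE: "finite E" unfolding E_def by (intro finite_PiE fin)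
  have 1: "split f \<in> Y \<and> join (split f) = f \<and> (case split f of (p, \<sigma>) \<Rightarrow> weight (cyclic_weight P) k S p) = w f"
    if fE: "f \<in> E" for f
  proof -
    have fS: "\<And>x. x \<in> S \<Longrightarrow> f x \<in> S" using fE by (auto simp: E_def)
    define p \<sigma> where "p = fst (split f)" and "\<sigma> = snd (split f)"
    have s: "split f = (p, \<sigma>)" by (simp add: p_def \<sigma>_def)
    note c = cyclic_split[OF fin zero fS]
    have p: "p \<in> forests S" and r: "roots S p = cyclic_points S f" and \<sigma>: "\<sigma> permutes roots S p"
      using c by (simp_all add: p_def \<sigma>_def split_def Let_def)
    have fe: "f x = (if p x = 0 then \<sigma> x else p x)" if "x \<in> S" for x
      using fS[OF that] zero that by (auto simp: p_def \<sigma>_def split_def Let_def)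
    have "join (p, \<sigma>) = f"
    proof
      fix x
      show "join (p, \<sigma>) x = f x"
        using fe[of x] PiE_arb[OF fE[unfolded E_def], of x] by (cases "x \<in> S") (simp_all add: join_def)
    qed
    moreover have "w f = weight (cyclic_weight P) k S p"
      unfolding w_def by (rule join_weight[OF fin zero p \<sigma> fe])
    ultimately show ?thesis unfolding s using p \<sigma> by (simp add: Y_def)
  qed
  have 2: "join b \<in> E \<and> split (join b) = b" if bY: "b \<in> Y" for b
  proof -
    obtain p \<sigma> where b: "b = (p, \<sigma>)" by force
    have p: "p \<in> forests S" and \<sigma>: "\<sigma> permutes roots S p" using bY by (auto simp: Y_def b)
    define f where "f = join b"
    have fe: "f x = (if p x = 0 then \<sigma> x else p x)" if "x \<in> S" for x
      using that by (simp add: f_def join_def b)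
    have "f x \<in> S" if "x \<in> S" for x using join_in[OF fin zero p \<sigma> fe that] by simp
    moreover have "f x = undefined" if "x \<notin> S" for x using that by (simp add: f_def join_def b)
    ultimately have "f \<in> E" by (auto simp: E_def)
    have C: "cyclic_points S f = roots S p" by (rule cyclic_points_join[OF fin zero p \<sigma> fe])
    have "(if x \<in> S - roots S p then f x else 0) = p x" for x
      using fe[of x] forests_out[OF p, of x] by (auto simp: roots_def)
    moreover have "(if x \<in> roots S p then f x else x) = \<sigma> x" for x
      using fe[of x] permutes_not_in[OF \<sigma>, of x] by (auto simp: roots_def)
    ultimately have "split f = b" by (simp add: split_def C b)
    then show ?thesis using \<open>f \<in> E\<close> by (simp add: f_def)
  qed
  have "funsP P n = {f \<in> E. \<forall>x\<in>S. card {y \<in> S. f y = x} \<in> P}"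
    by (simp add: funsP_def E_def S_def)
  then have "(\<Sum>f\<in>funsP P n. monom 1 (n - card ((f ^^ k) ` {1..n}))) = (\<Sum>f\<in>E. w f)"
    unfolding w_def sum.inter_filter[OF finE, symmetric] by (simp add: S_def)
  also have "\<dots> = (\<Sum>(p, \<sigma>)\<in>Y. weight (cyclic_weight P) k S p)"
    by (rule sum.reindex_bij_witness[where i = join and j = split]) (use 1 2 in blast)+
  also have "\<dots> = (\<Sum>p\<in>forests S. \<Sum>\<sigma>\<in>{\<sigma>. \<sigma> permutes roots S p}. weight (cyclic_weight P) k S p)"
    unfolding Y_def
    by (rule sum.Sigma[symmetric]) (use fin finr in \<open>simp_all add: finite_forests finite_permutations\<close>)
  \<comment> \<open>The weight does not involve \<open>\<sigma>\<close>, so each forest counts once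
    per permutation of its roots.\<close>
  also have "\<dots> = (\<Sum>p\<in>forests S. of_nat (fact (card (roots S p))) * weight (cyclic_weight P) k S p)"
    using finr by (simp add: card_permutations)
  also have "\<dots> = (\<Sum>j\<le>n. \<Sum>p\<in>{p \<in> forests S. card (roots S p) = j}.
      of_nat (fact (card (roots S p))) * weight (cyclic_weight P) k S p)"
    using finite_forests[OF fin] card_mono[OF fin] card
    by (intro sum.group[symmetric]) (auto simp: roots_def)
  also have "\<dots> = (\<Sum>j\<le>n. of_nat (fact j) * forest_sum (cyclic_weight P) k j S)"
    unfolding forest_sum_def sum_distrib_left by (intro sum.cong) auto
  finally show ?thesis by (simp add: S_def)
qed

subsection \<open>Exponential generating functions\<close>

context
  assumes QR: "\<forall>n::nat. n > 0 \<longrightarrow> (of_nat n :: 'a::comm_ring_1) dvd 1"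
begin

text \<open>Inverses in a commutative ring are unique, so the definite description picks any inverse
  that is exhibited.\<close>

lemma natinv_eqI:
  assumes "of_nat n * x = (1 :: 'a)" shows "natinv n = x"
  unfolding natinv_def
proof (rule the_equality)
  fix y :: 'a assume "of_nat n * y = 1"
  then show "y = x" using assms by (metis mult.assoc mult.commute mult_1)
qed (rule assms)

lemma of_nat_natinv:
  assumes "n > 0" shows "of_nat n * natinv n = (1 :: 'a)"
proof -
  obtain x where "of_nat n * x = (1 :: 'a)" using QR assms by (metis dvdE)
  then show ?thesis using natinv_eqI by metis
qed

lemma natinv_mult:
  assumes "m > 0" "n > 0" shows "natinv (m * n) = natinv m * (natinv n :: 'a)"
proof (rule natinv_eqI)
  have "of_nat (m * n) * (natinv m * natinv n) = (of_nat m * natinv m) * (of_nat n * natinv n :: 'a)"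
    by (simp add: ac_simps)
  then show "of_nat (m * n) * (natinv m * natinv n) = (1 :: 'a)"
    using assms by (simp add: of_nat_natinv)
qed

lemma natinv_1: "natinv (Suc 0) = (1 :: 'a)"
  by (rule natinv_eqI) simp

text \<open>Invert \<open>fact n = fact i * fact (n - i) * (n choose i)\<close> factor by factor. R
  may have zero divisors, but every factor is a unit.\<close>

lemma natinv_fact_choose:
  assumes "i \<le> n"
  shows "natinv (fact n) * of_nat (n choose i) = natinv (fact i) * (natinv (fact (n - i)) :: 'a)"
proof -
  have pos: "n choose i > 0" using assms by simp
  have "fact n = fact i * fact (n - i) * (n choose i)"
    using binomial_fact_lemma[OF assms] by simp
  then have "natinv (fact n) = natinv (fact i) * natinv (fact (n - i)) * (natinv (n choose i) :: 'a)"
    using pos by (simp add: natinv_mult)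
  then have "natinv (fact n) * of_nat (n choose i)
      = natinv (fact i) * natinv (fact (n - i)) * (of_nat (n choose i) * natinv (n choose i) :: 'a)"
    by (simp add: ac_simps)
  then show ?thesis using of_nat_natinv[OF pos] by simp
qed

end

definition egf :: "(nat \<Rightarrow> 'a::comm_ring_1 poly) \<Rightarrow> 'a poly fps" where
  "egf a = Abs_fps (\<lambda>n. smult (natinv (fact n)) (a n))"

lemma egf_nth: "egf a $ n = smult (natinv (fact n)) (a n)"
  by (simp add: egf_def)

lemma of_nat_mult_poly: "of_nat n * p = smult (of_nat n) p"
  by (simp add: of_nat_poly)

lemma smult_sum_right: "smult c (\<Sum>i\<in>S. f i) = (\<Sum>i\<in>S. smult c (f i))"
  by (induction S rule: infinite_finite_induct) (simp_all add: smult_add_right)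

lemma egf_of_nat_mult: "of_nat c * egf a = egf (\<lambda>n. of_nat c * a n)"
  by (rule fps_ext) (simp add: egf_nth of_nat_mult_poly ac_simps)

context
  assumes QR: "\<forall>n::nat. n > 0 \<longrightarrow> (of_nat n :: 'a::comm_ring_1) dvd 1"
begin

lemma egf_mult:
  fixes a b :: "nat \<Rightarrow> 'a poly"
  shows "egf a * egf b = egf (\<lambda>n. \<Sum>i\<le>n. of_nat (n choose i) * (a i * b (n - i)))"
proof (rule fps_ext)
  fix n
  have "(egf a * egf b) $ n = (\<Sum>i\<le>n. smult (natinv (fact i) * natinv (fact (n - i))) (a i * b (n - i)))"
    by (simp add: fps_mult_nth egf_nth atLeast0AtMost mult.commute)
  also have "\<dots> = (\<Sum>i\<le>n. smult (natinv (fact n) * of_nat (n choose i)) (a i * b (n - i)))"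
    by (intro sum.cong refl) (simp add: natinv_fact_choose[OF QR])
  also have "\<dots> = egf (\<lambda>n. \<Sum>i\<le>n. of_nat (n choose i) * (a i * b (n - i))) $ n"
    by (simp add: egf_nth smult_sum_right of_nat_mult_poly)
  finally show "(egf a * egf b) $ n = \<dots>" .
qed

lemma egf_forest_sum_power:
  fixes g :: "bool \<Rightarrow> nat \<Rightarrow> bool \<Rightarrow> 'a poly"
  shows "of_nat (fact j) * egf (\<lambda>n. forest_sum g k j {1..n}) = egf (\<lambda>n. forest_sum g k 1 {1..n}) ^ j"
proof (induction j)
  case 0
  have "egf (\<lambda>n. forest_sum g k 0 {1..n}) = 1"
    by (rule fps_ext) (simp add: egf_nth forest_sum_0 natinv_1[OF QR])
  then show ?case by simp
next
  case (Suc j)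
  \<comment> \<open>Only cardinalities matter, so sums over label sets become sequences.\<close>
  define u where "u = (\<lambda>j n. forest_sum g k j {1..n})"
  have u: "forest_sum g k i A = u i (card A)" if "A \<subseteq> {1..n}" for i A n
    unfolding u_def using that
    by (intro forest_sum_card_cong) (auto intro: finite_subset)
  have "of_nat (Suc j) * u (Suc j) n = (\<Sum>i\<le>n. of_nat (n choose i) * (u 1 i * u j (n - i)))" for n
  proof -
    have "of_nat (Suc j) * u (Suc j) n
        = (\<Sum>A\<in>Pow {1..n}. forest_sum g k 1 A * forest_sum g k j ({1..n} - A))"
      unfolding u_def by (rule forest_sum_Suc) auto
    also have "\<dots> = (\<Sum>A\<in>Pow {1..n}. u 1 (card A) * u j (n - card A))"
    proof (intro sum.cong refl)
      fix A assume "A \<in> Pow {1..n}"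
      then have A: "A \<subseteq> {1..n}" by simp
      then have "card ({1..n} - A) = n - card A" by (simp add: card_Diff_subset finite_subset)
      then show "forest_sum g k 1 A * forest_sum g k j ({1..n} - A) = u 1 (card A) * u j (n - card A)"
        using u[OF A] u[of "{1..n} - A" n] by simp
    qed
    finally show ?thesis using sum_Pow_card[of "{1..n}" "\<lambda>i. u 1 i * u j (n - i)"] by simp
  qed
  then have step: "of_nat (Suc j) * egf (u (Suc j)) = egf (u 1) * egf (u j)"
    by (simp only: egf_of_nat_mult egf_mult)
  have IH: "of_nat (fact j) * egf (u j) = egf (u 1) ^ j" using Suc by (simp add: u_def)
  have "of_nat (fact (Suc j)) * egf (u (Suc j)) = of_nat (fact j) * (of_nat (Suc j) * egf (u (Suc j)))"
    by (simp only: fact_Suc of_nat_mult of_nat_id ac_simps)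
  also have "\<dots> = egf (u 1) * (of_nat (fact j) * egf (u j))"
    unfolding step by (rule mult.left_commute)
  also have "\<dots> = egf (u 1) ^ Suc j" unfolding IH by simp
  finally show ?case by (simp only: u_def)
qed

end

text \<open>As V has no constant term, \<open>V ^ j\<close> contributes nothing below degree
  \<open>j\<close>. Up to degree \<open>n\<close> the series \<open>F\<close> agrees with a partial
  geometric sum, whose telescoped product with \<open>1 - V\<close> differs from 1 only above degree
  \<open>n\<close>.\<close>

lemma geometric_fps:
  fixes V F :: "'b::comm_ring_1 fps"
  assumes V: "V $ 0 = 0" and F: "\<And>n. F $ n = (\<Sum>j\<le>n. (V ^ j) $ n)"
  shows "F * (1 - V) = 1"
proof (rule fps_ext)
  fix n
  have "F $ i = (\<Sum>j\<le>n. V ^ j) $ i" if "i \<le> n" for i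
  proof -
    have "(\<Sum>j\<le>i. (V ^ j) $ i) = (\<Sum>j\<le>n. (V ^ j) $ i)"
      using that startsby_zero_power_prefix[OF V] by (intro sum.mono_neutral_left) auto
    then show ?thesis by (simp add: F fps_sum_nth)
  qed
  then have "(F * (1 - V)) $ n = ((\<Sum>j\<le>n. V ^ j) * (1 - V)) $ n"
    by (simp add: fps_mult_nth)
  also have "(\<Sum>j\<le>n. V ^ j) * (1 - V) = 1 - V ^ Suc n"
    by (simp add: sum_gp_basic mult.commute del: power_Suc)
  also have "(1 - V ^ Suc n) $ n = 1 $ n"
    using startsby_zero_power_prefix[OF V, of "Suc n"] by (simp del: power_Suc)
  finally show "(F * (1 - V)) $ n = 1 $ n" .
qed

theorem theorem5p4:
  fixes k :: nat and P :: "nat set"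
  assumes QR: "\<forall>n::nat. n > 0 \<longrightarrow> (of_nat n :: 'a::comm_ring_1) dvd 1"
  shows "(FkP k P :: 'a poly fps) * (1 - fps_X * (eP (shiftP P) oo TkP k P)) = 1"
proof -
  define u :: "nat \<Rightarrow> nat \<Rightarrow> 'a poly" where "u = (\<lambda>j n. forest_sum (tree_weight P) k j {1..n})"
  define v :: "nat \<Rightarrow> nat \<Rightarrow> 'a poly" where "v = (\<lambda>j n. forest_sum (cyclic_weight P) k j {1..n})"
  have T: "TkP k P = egf (u 1)"
    unfolding TkP_def egf_def u_def sum_rooted_trees ..
  have u: "of_nat (fact j) * egf (u j) = egf (u 1) ^ j" for j
    unfolding u_def by (rule egf_forest_sum_power[OF QR])
  have v: "of_nat (fact j) * egf (v j) = egf (v 1) ^ j" for j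
    unfolding v_def by (rule egf_forest_sum_power[OF QR])
  \<comment> \<open>There are \<open>n\<close> choices of the root and \<open>n - 1\<close> labels
    for the rest; at \<open>n = 0\<close> the factor \<open>of_nat n\<close> makes the truncated
    subtraction harmless.\<close>
  have v1: "v 1 n = of_nat n * (\<Sum>j\<in>{j. j \<le> n - 1 \<and> j \<in> shiftP P}. u j (n - 1))" for n
  proof -
    have "v 1 n = (\<Sum>c\<in>{1..n}. \<Sum>j\<in>{j. j \<le> card ({1..n} - {c}) \<and> j \<in> shiftP P}.
        forest_sum (tree_weight P) k j ({1..n} - {c}))"
      unfolding v_def
      by (rule forest_sum_remove_root) (auto simp: cyclic_weight_def tree_weight_def)
    also have "\<dots> = (\<Sum>c\<in>{1..n}. \<Sum>j\<in>{j. j \<le> n - 1 \<and> j \<in> shiftP P}. u j (n - 1))"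
      unfolding u_def by (intro sum.cong forest_sum_card_cong) auto
    finally show ?thesis by simp
  qed
  have V: "fps_X * (eP (shiftP P) oo TkP k P) = egf (v 1)"
  proof (rule fps_ext)
    fix n
    show "(fps_X * (eP (shiftP P) oo TkP k P)) $ n = egf (v 1) $ n"
    proof (cases n)
      case 0
      then show ?thesis using v1[of 0] by (simp add: egf_nth)
    next
      case (Suc m)
      \<comment> \<open>The coefficient 1/j! of the exponential series cancels the j! of the power
        rule and leaves the forests with exactly \<open>j\<close> roots.\<close>
      have "eP (shiftP P) $ j * (egf (u 1) ^ j) $ m = (if j \<in> shiftP P then egf (u j) $ m else 0)" for j
      proof -
        have "[:natinv (fact j):] * (of_nat (fact j) * x) = x" for x :: "'a poly"
          using of_nat_natinv[OF QR, of "fact j"] by (simp only: of_nat_mult_poly) (simp add: mult.commute)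
        then show ?thesis unfolding u[symmetric] by (simp add: eP_def del: of_nat_fact)
      qed
      \<comment> \<open>Composition takes \<open>j\<close> only up to \<open>m\<close>; nothing is
        lost, since trees are nonempty and T has no constant term.\<close>
      then have "(eP (shiftP P) oo TkP k P) $ m = (\<Sum>j\<in>{0..m}. if j \<in> shiftP P then egf (u j) $ m else 0)"
        unfolding fps_compose_nth T by simp
      also have "\<dots> = (\<Sum>j\<in>{j. j \<le> m \<and> j \<in> shiftP P}. egf (u j) $ m)"
        by (simp add: sum.inter_filter[symmetric])
      also have "\<dots> = smult (natinv (fact m)) (\<Sum>j\<in>{j. j \<le> m \<and> j \<in> shiftP P}. u j m)"
        by (simp add: egf_nth smult_sum_right)
      \<comment> \<open>The effect of the factor z: m! gives way to (m + 1)!, and m + 1 is the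
        number of choices of the root.\<close>
      also have "natinv (fact m) = natinv (fact (Suc m)) * (of_nat (Suc m) :: 'a)"
        using natinv_fact_choose[OF QR, of m "Suc m"] natinv_1[OF QR] by simp
      also have "smult \<dots> (\<Sum>j\<in>{j. j \<le> m \<and> j \<in> shiftP P}. u j m) = egf (v 1) $ n"
        using v1[of n] Suc by (simp add: egf_nth of_nat_mult_poly del: of_nat_Suc fact_Suc)
      finally show ?thesis using Suc by simp
    qed
  qed
  show ?thesis unfolding V
  proof (rule geometric_fps)
    show "egf (v 1) $ 0 = 0" using v1[of 0] by (simp add: egf_nth)
    show "FkP k P $ n = (\<Sum>j\<le>n. (egf (v 1) ^ j) $ n)" for n
    proof -
      \<comment> \<open>The j! permutations of the roots meet the j! of the power rule, which is why
        a geometric and not an exponential series arises.\<close>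
      have "FkP k P $ n = smult (natinv (fact n)) (\<Sum>j\<le>n. of_nat (fact j) * v j n)"
        unfolding FkP_def sum_funsP v_def by simp
      also have "\<dots> = (\<Sum>j\<le>n. (of_nat (fact j) * egf (v j)) $ n)"
        unfolding egf_of_nat_mult by (simp add: egf_nth smult_sum_right)
      finally show ?thesis by (simp only: v)
    qed
  qed
qed

end
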